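(* Let $R>0$ and, for $r>0$, let $B(0,r)$ denote the closed disk of radius $r$ centered at the origin of $\mathbb{R}^2$. Let $A\subset\mathbb{R}^2$ be a nonempty closed $C^1$ embedded $1$-dimensional submanifold of $\mathbb{R}^2$ such that $A\subset B(0,R)$ and $\mathcal{H}^1(A)<\infty$. Let $f:\mathbb{R}^2\to\mathbb{R}$, $f(x)=\inf\{|x-y| \mid y\in A\}$, be the distance function to $A$. Then $$\lim_{k\to\infty}\left\{\frac{1}{k}\int_{B(0,2R)}\left(\frac{|Df(y)|}{|f(y)|}\right)^{\frac{k-1}{k}}dy\right\}=2\,\mathcal{H}^1(A).$$
   Context: "Closed submanifold" means compact and without boundary. That $A$ is a $C^1$ embedded $1$-dimensional submanifold means that $A$ is locally (after a suitable change of coordinates, in a neighborhood in $\mathbb{R}^2$ of each of its points) the graph of a $C^1$ function $g:\mathbb{R}\to\mathbb{R}$. $|\cdot|$ is the Euclidean norm and $dy$ is Lebesgue measure on $\mathbb{R}^2$. The distance function $f$ is Lipschitz, so $Df$ exists almost everywhere; the integrand is defined almost everywhere (off the Lebesgue-null set consisting of $A$ and the points where $f$ is not differentiable). $\mathcal{H}^1$ is $1$-dimensional Hausdorff measure on $\mathbb{R}^2$, normalized so that it agrees with length on line segments. The limit is over positive integers $k$. *)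

theory Defs
  imports "HOL-Analysis.Analysis"
begin

definition C1_map_on ::
    "('a::real_normed_vector \<Rightarrow> 'b::real_normed_vector) \<Rightarrow> 'a set \<Rightarrow> bool" where
  "C1_map_on f U \<longleftrightarrow>
     (\<exists>f' :: 'a \<Rightarrow> 'a \<Rightarrow>\<^sub>L 'b.
        (\<forall>x\<in>U. (f has_derivative blinfun_apply (f' x)) (at x)) \<and> continuous_on U f')"

definition C1_diffeomorphism ::
    "'a::real_normed_vector set \<Rightarrow> 'b::real_normed_vector set \<Rightarrow>
       ('a \<Rightarrow> 'b) \<Rightarrow> ('b \<Rightarrow> 'a) \<Rightarrow> bool" where
  "C1_diffeomorphism U V \<phi> \<psi> \<longleftrightarrow>
     open U \<and> open V \<and> homeomorphism U V \<phi> \<psi> \<and> C1_map_on \<phi> U \<and> C1_map_on \<psi> V"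

text \<open>
  The changes of coordinates are local \<open>C\<^sup>1\<close> diffeomorphisms of the plane, which include
  rotations and other rigid motions. Requiring a graph over all of \<open>\<real>\<close> (restricted to the
  coordinate neighbourhood \<open>V\<close>) leaves no room for boundary points.
\<close>

definition C1_embedded_curve :: "(real^2) set \<Rightarrow> bool" where
  "C1_embedded_curve A \<longleftrightarrow>
     (\<forall>x\<in>A. \<exists>U V \<phi> \<psi>. \<exists>g :: real \<Rightarrow> real.
        x \<in> U \<and> C1_diffeomorphism U V \<phi> \<psi> \<and> g C1_differentiable_on UNIV \<and>
        \<phi> ` (A \<inter> U) = V \<inter> {v :: real^2. v $ 2 = g (v $ 1)})"

definition closed_C1_embedded_curve :: "(real^2) set \<Rightarrow> bool" where
  "closed_C1_embedded_curve A \<longleftrightarrow> compact A \<and> C1_embedded_curve A"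

text \<open>
  One-dimensional Hausdorff measure, by countable covers of small diameter. A segment can be covered
  by pieces whose diameters add up to its length, so no further normalising constant is needed.
  Boundedness of the covering sets is required because \<^const>\<open>diameter\<close> is real-valued
  and carries no information on unbounded sets.
\<close>

definition hausdorff1_delta :: "real \<Rightarrow> 'a::metric_space set \<Rightarrow> ennreal" where
  "hausdorff1_delta \<delta> S =
     (INF C \<in> {C :: nat \<Rightarrow> 'a set. S \<subseteq> (\<Union>i. C i) \<and> (\<forall>i. bounded (C i) \<and> diameter (C i) \<le> \<delta>)}.
        \<Sum>i. ennreal (diameter (C i)))"

definition hausdorff1 :: "'a::metric_space set \<Rightarrow> ennreal" where
  "hausdorff1 S = (SUP \<delta>\<in>{0<..}. hausdorff1_delta \<delta> S)"

text \<open>The value is unspecified at points where \<open>f\<close> is not differentiable.\<close>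

definition gradient :: "('a::real_inner \<Rightarrow> real) \<Rightarrow> 'a \<Rightarrow> 'a" where
  "gradient f x = (THE D. GDERIV f x :> D)"

end

theory Submission
  imports Defs
begin

text \<open>
  Almost every point has a unique nearest point in \<open>A\<close>, and there the distance function
  is differentiable with a gradient of norm one; so the integrand is \<open>f powr (s - 1)\<close> almost
  everywhere, where \<open>s = 1 / k\<close>. By the layer cake formula the factor \<open>s\<close> singles out, as \<open>s\<close> tends
  to \<open>0\<close>, the linear rate at which the area of the tube of radius \<open>t\<close> around \<open>A\<close> grows near
  \<open>t = 0\<close>. This rate is twice the length: \<open>A\<close> is a finite union of compact pieces that overlap in
  finitely many points and are graphs of small slope over compact subsets of lines, and for such a
  piece both the length and the normalised area of the tube are close to the measure of the
  projection to the line.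
\<close>

subsection \<open>Orthonormal frames of the plane\<close>

text \<open>A C1 curve need not have a neighbourhood in which nearest points are unique, so no
  change of variables along normals is available; covers, projections and slices take its place.
  Bounds from above, for length and for tube area, are subadditive and tolerate overlapping pieces.
  Bounds from below need pieces at positive distance from each other, so that neither a small
  covering set nor a thin tube sees two of them. Because the overlaps are finite, small discs around
  the overlap points can be cut out, at an arbitrarily small cost in projected measure. If the tube
  of radius t had area exactly c t up to radius \<epsilon>, then s times the integral over that tube
  would be exactly c \<epsilon>^s, which tends to c as s tends to 0. Away from the tube the
  integrand is bounded uniformly in s, so the factor s removes that part. Hence \<epsilon> is fixed
  before the limit is taken.\<close>

definition frame :: "real^2 \<Rightarrow> real^2 \<Rightarrow> bool" where
  "frame e n \<longleftrightarrow> norm e = 1 \<and> norm n = 1 \<and> e \<bullet> n = 0"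

lemma frame_swap: "frame e n \<Longrightarrow> frame n e"
  by (auto simp: frame_def inner_commute)

lemma frame_inner [simp]:
  assumes "frame e n"
  shows "e \<bullet> (u *\<^sub>R e + v *\<^sub>R n) = u" "n \<bullet> (u *\<^sub>R e + v *\<^sub>R n) = v"
proof -
  have "e \<bullet> e = 1" "n \<bullet> n = 1" "e \<bullet> n = 0" "n \<bullet> e = 0"
    using assms by (auto simp: frame_def dot_square_norm inner_commute)
  then show "e \<bullet> (u *\<^sub>R e + v *\<^sub>R n) = u" "n \<bullet> (u *\<^sub>R e + v *\<^sub>R n) = v"
    by (auto simp: inner_add_right)
qed

lemma frame_orthogonal_transformation:
  assumes "frame e n"
  shows "orthogonal_transformation (\<lambda>x::real^2. (x$1) *\<^sub>R e + (x$2) *\<^sub>R n)"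
  unfolding orthogonal_transformation_def
proof (intro conjI allI)
  show "linear (\<lambda>x::real^2. (x$1) *\<^sub>R e + (x$2) *\<^sub>R n)"
    by (rule linearI) (auto simp: algebra_simps)
  fix v w :: "real^2"
  have "e \<bullet> e = 1" "n \<bullet> n = 1" "e \<bullet> n = 0" "n \<bullet> e = 0"
    using assms by (auto simp: frame_def dot_square_norm inner_commute)
  then have "(v$1 *\<^sub>R e + v$2 *\<^sub>R n) \<bullet> (w$1 *\<^sub>R e + w$2 *\<^sub>R n) = v$1 * w$1 + v$2 * w$2"
    by (simp add: inner_add_left inner_add_right)
  then show "(v$1 *\<^sub>R e + v$2 *\<^sub>R n) \<bullet> (w$1 *\<^sub>R e + w$2 *\<^sub>R n) = v \<bullet> w"
    by (simp add: inner_vec_def sum_2)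
qed

lemma frame_expand:
  assumes "frame e n"
  shows "(e \<bullet> x) *\<^sub>R e + (n \<bullet> x) *\<^sub>R n = x"
proof -
  from orthogonal_transformation_surj[OF frame_orthogonal_transformation[OF assms]]
  obtain y :: "real^2" where "x = (y$1) *\<^sub>R e + (y$2) *\<^sub>R n" by (meson surjD)
  with assms show ?thesis by simp
qed

lemma frame_norm:
  assumes "frame e n"
  shows "(norm x)\<^sup>2 = (e \<bullet> x)\<^sup>2 + (n \<bullet> x)\<^sup>2"
  using arg_cong[OF frame_expand[OF assms, of x], of "\<lambda>y. x \<bullet> y"]
  by (simp add: inner_add_right dot_square_norm power2_eq_square inner_commute)

lemma frame_norm_le:
  assumes "frame e n"
  shows "norm x \<le> \<bar>e \<bullet> x\<bar> + \<bar>n \<bullet> x\<bar>"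
proof (rule power2_le_imp_le)
  show "(norm x)\<^sup>2 \<le> (\<bar>e \<bullet> x\<bar> + \<bar>n \<bullet> x\<bar>)\<^sup>2"
    unfolding frame_norm[OF assms] by (simp add: power2_sum)
qed simp

lemma frame_inner_le:
  assumes "frame e n"
  shows "\<bar>e \<bullet> x\<bar> \<le> norm x" "\<bar>n \<bullet> x\<bar> \<le> norm x"
  using assms Cauchy_Schwarz_ineq2[of e x] Cauchy_Schwarz_ineq2[of n x] by (auto simp: frame_def)

lemma frame_exists:
  assumes "norm e = 1"
  obtains n where "frame e n"
proof -
  define n :: "real^2" where "n = vector [- e$2, e$1]"
  have e: "e \<bullet> e = 1" using assms by (simp add: dot_square_norm)
  have "n \<bullet> n = e \<bullet> e" "e \<bullet> n = 0"
    by (simp_all add: n_def inner_vec_def sum_2 algebra_simps)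
  with e assms have "frame e n" by (auto simp: frame_def norm_eq_sqrt_inner)
  with that show ?thesis by blast
qed

text \<open>The inverse of the coordinate map is an orthogonal transformation, so the preimage of a
  box is a rotated box of the same area, and Lebesgue measure is determined by its values on
  boxes.\<close>

lemma distr_frame:
  assumes fr: "frame e n"
  shows "distr lborel borel (\<lambda>x. (e \<bullet> x, n \<bullet> x)) = (lborel :: (real \<times> real) measure)"
proof (rule lborel_eqI[symmetric])
  fix l u :: "real \<times> real"
  assume lu: "\<And>b. b \<in> Basis \<Longrightarrow> l \<bullet> b \<le> u \<bullet> b"
  obtain l1 l2 u1 u2 where [simp]: "l = (l1, l2)" "u = (u1, u2)" by (cases l, cases u)
  from lu[of "(1,0)"] lu[of "(0,1)"] have le: "l1 \<le> u1" "l2 \<le> u2" by (auto simp: Basis_prod_def)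
  let ?T = "\<lambda>x::real^2. (x$1) *\<^sub>R e + (x$2) *\<^sub>R n"
  let ?B = "box (vector [l1, l2]) (vector [u1, u2] :: real^2)"
  have "(\<lambda>x. (e \<bullet> x, n \<bullet> x)) -` box l u = ?T ` ?B" (is "?L = _")
  proof (intro equalityI subsetI)
    fix x assume "x \<in> ?L"
    then have "(vector [e \<bullet> x, n \<bullet> x] :: real^2) \<in> ?B"
      by (auto simp: mem_box_cart forall_2 mem_box Basis_prod_def)
    moreover have "x = ?T (vector [e \<bullet> x, n \<bullet> x])" using frame_expand[OF fr, of x] by simp
    ultimately show "x \<in> ?T ` ?B" by blast
  qed (use fr in \<open>auto simp: mem_box_cart forall_2 mem_box Basis_prod_def\<close>)
  then have "emeasure (distr lborel borel (\<lambda>x. (e \<bullet> x, n \<bullet> x))) (box l u) = emeasure lborel (?T ` ?B)"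
    by (subst emeasure_distr) auto
  also have "\<dots> = emeasure lebesgue (?T ` ?B)"
  proof -
    have "?L = (\<lambda>x. (e \<bullet> x, n \<bullet> x)) -` box l u \<inter> space borel" by simp
    also have "\<dots> \<in> sets borel" by (rule measurable_sets[of _ _ borel]) auto
    finally show ?thesis using \<open>?L = ?T ` ?B\<close> by simp
  qed
  also have "\<dots> = ennreal (measure lebesgue (?T ` ?B))"
    using measurable_orthogonal_image[OF frame_orthogonal_transformation[OF fr], of ?B]
    by (simp add: emeasure_eq_measure2 fmeasurableD fmeasurableD2)
  also have "\<dots> = ennreal (measure lebesgue ?B)"
    using measure_orthogonal_image[OF frame_orthogonal_transformation[OF fr], of ?B] by simp
  also have "measure lebesgue ?B = (u1 - l1) * (u2 - l2)"
  proof -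
    have B: "(Basis :: (real^2) set) = {axis 1 1, axis 2 1}"
      by (auto simp: Basis_vec_def UNIV_2)
    have "axis 1 1 \<noteq> (axis 2 1 :: real^2)" by (simp add: axis_eq_axis)
    then show ?thesis using le
      by (simp add: measure_lborel_box_eq B inner_axis mult.commute)
  qed
  also have "ennreal \<dots> = ennreal (\<Prod>b\<in>Basis. (u - l) \<bullet> b)"
    by (subst Basis_prod_def) (auto simp: prod.union_disjoint mult.commute)
  finally show "emeasure (distr lborel borel (\<lambda>x. (e \<bullet> x, n \<bullet> x))) (box l u) = ennreal (\<Prod>b\<in>Basis. (u - l) \<bullet> b)" .
qed simp

text \<open>Tonelli in rotated coordinates: area is the integral of the lengths of the slices in
  direction \<open>n\<close>.\<close>

lemma emeasure_frame_slices:
  assumes fr: "frame e n" and X: "X \<in> sets borel"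
  shows "emeasure lborel X = (\<integral>\<^sup>+u. emeasure lborel {v. u *\<^sub>R e + v *\<^sub>R n \<in> X} \<partial>lborel)"
proof -
  define Y where "Y = {p. fst p *\<^sub>R e + snd p *\<^sub>R n \<in> X}"
  have "Y = (\<lambda>p. fst p *\<^sub>R e + snd p *\<^sub>R n) -` X \<inter> space borel" by (auto simp: Y_def)
  also have "\<dots> \<in> sets (borel :: (real \<times> real) measure)"
    by (rule measurable_sets[OF _ X]) (intro borel_measurable_continuous_onI continuous_intros)
  finally have Y: "Y \<in> sets borel" .
  have "emeasure lborel X = emeasure (distr lborel borel (\<lambda>x. (e \<bullet> x, n \<bullet> x))) Y"
    using Y by (subst emeasure_distr) (auto simp: Y_def frame_expand[OF fr])
  also have "\<dots> = emeasure (lborel \<Otimes>\<^sub>M lborel) Y"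
    by (simp add: distr_frame[OF fr] lborel_prod)
  also have "\<dots> = (\<integral>\<^sup>+u. emeasure lborel (Pair u -` Y) \<partial>lborel)"
    by (rule lborel.emeasure_pair_measure_alt) (metis Y lborel_prod sets_lborel)
  also have "\<dots> = (\<integral>\<^sup>+u. emeasure lborel {v. u *\<^sub>R e + v *\<^sub>R n \<in> X} \<partial>lborel)"
    by (simp add: Y_def vimage_def)
  finally show ?thesis .
qed

subsection \<open>Almost everywhere differentiability of the distance function\<close>

definition nearest :: "'a::metric_space set \<Rightarrow> 'a \<Rightarrow> 'a \<Rightarrow> bool" where
  "nearest A x p \<longleftrightarrow> p \<in> A \<and> dist x p = infdist x A"

lemma nearest_le: "nearest A x p \<Longrightarrow> q \<in> A \<Longrightarrow> dist x p \<le> dist x q"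
  by (simp add: nearest_def infdist_le)

lemma nearest_exists:
  fixes A :: "'a::heine_borel set"
  assumes "compact A" "A \<noteq> {}"
  obtains p where "nearest A x p"
proof -
  obtain p where "p \<in> A" "infdist x A = dist x p"
    using infdist_attains_inf[OF compact_imp_closed[OF assms(1)] assms(2)] by metis
  with that show ?thesis by (simp add: nearest_def)
qed

text \<open>Adding the two squared minimality conditions and expanding leaves only mixed terms.
  Behind this, nearest points are subgradients of the convex function (|x|^2 - dist(x, A)^2) / 2,
  and subgradients are monotone.\<close>

lemma nearest_monotone:
  fixes A :: "'a::real_inner set"
  assumes "nearest A x p" "nearest A y q"
  shows "0 \<le> (y - x) \<bullet> (q - p)"
proof -
  have "dist x p \<le> dist x q" "dist y q \<le> dist y p"
    using assms by (auto simp: nearest_le nearest_def infdist_le)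
  then have "(dist x p)\<^sup>2 + (dist y q)\<^sup>2 \<le> (dist x q)\<^sup>2 + (dist y p)\<^sup>2"
    by (intro add_mono power_mono) auto
  then show ?thesis
    by (simp add: dist_norm power2_norm_eq_inner algebra_simps inner_commute)
qed

text \<open>The set is the projection of a closed set along the compact factor
  \<open>A \<times> A\<close>. The non-strict threshold \<open>c\<close> is what makes it closed; a
  strict inequality is recovered by a countable union over positive thresholds.\<close>

lemma closed_ambiguous:
  fixes A :: "'a::euclidean_space set"
  assumes "compact A"
  shows "closed {x. \<exists>p q. nearest A x p \<and> nearest A x q \<and> c \<le> a \<bullet> q - a \<bullet> p}"
proof -
  let ?T = "{(w :: 'a \<times> 'a, x). dist x (fst w) = infdist x A \<and> dist x (snd w) = infdist x A
              \<and> c \<le> a \<bullet> snd w - a \<bullet> fst w}"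
  have "closed ?T"
    unfolding case_prod_unfold
    by (intro closed_Collect_conj closed_Collect_eq closed_Collect_le continuous_intros)
  from closed_compact_projection[OF compact_Times[OF assms assms] this]
  have "closed {x. \<exists>w. w \<in> A \<times> A \<and> (w, x) \<in> ?T}" .
  also have "{x. \<exists>w. w \<in> A \<times> A \<and> (w, x) \<in> ?T} =
      {x. \<exists>p q. nearest A x p \<and> nearest A x q \<and> c \<le> a \<bullet> q - a \<bullet> p}"
    by (auto simp: nearest_def)
  finally show ?thesis .
qed

text \<open>On a line in direction \<open>n\<close> the \<open>n\<close>-coordinate of nearest points is monotone, so the intervals
  spanned by distinct nearest points are disjoint and only countably many can be nondegenerate.\<close>

lemma countable_ambiguous_slice:
  assumes fr: "frame e n"
  shows "countable {v. \<exists>p q. nearest A (u *\<^sub>R e + v *\<^sub>R n) p \<and> nearest A (u *\<^sub>R e + v *\<^sub>R n) q \<and> n \<bullet> p < n \<bullet> q}"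
proof -
  define S where "S = {v. \<exists>p q. nearest A (u *\<^sub>R e + v *\<^sub>R n) p \<and> nearest A (u *\<^sub>R e + v *\<^sub>R n) q \<and> n \<bullet> p < n \<bullet> q}"
  let ?x = "\<lambda>v. u *\<^sub>R e + v *\<^sub>R n"
  have "\<forall>v. \<exists>p q. v \<in> S \<longrightarrow> nearest A (?x v) p \<and> nearest A (?x v) q \<and> n \<bullet> p < n \<bullet> q"
    by (auto simp: S_def)
  then obtain p q where pq: "\<And>v. v \<in> S \<Longrightarrow> nearest A (?x v) (p v) \<and> nearest A (?x v) (q v) \<and> n \<bullet> p v < n \<bullet> q v"
    by metis
  define J where "J v = {n \<bullet> p v <..< n \<bullet> q v}" for v
  have ne: "J v \<noteq> {}" if "v \<in> S" for v using pq[OF that] by (simp add: J_def)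
  have disj: "J v \<inter> J w = {}" if "v \<in> S" "w \<in> S" "v < w" for v w
  proof -
    have "0 \<le> (?x w - ?x v) \<bullet> (p w - q v)"
      using nearest_monotone pq that by blast
    also have "?x w - ?x v = (w - v) *\<^sub>R n" by (simp add: algebra_simps)
    finally have "n \<bullet> q v \<le> n \<bullet> p w"
      using that(3) by (simp add: zero_le_mult_iff inner_diff_right)
    then show ?thesis by (auto simp: J_def)
  qed
  have disj': "J v \<inter> J w = {}" if "v \<in> S" "w \<in> S" "v \<noteq> w" for v w
    using disj[of v w] disj[of w v] that by (cases v w rule: linorder_cases) auto
  have "countable (J ` S)"
  proof (rule countable_disjoint_open_subsets)
    show "pairwise disjnt (J ` S)"
      using disj' unfolding pairwise_def disjnt_def by blast
  qed (auto simp: J_def)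
  moreover have "inj_on J S"
  proof (rule inj_onI, rule ccontr)
    fix v w assume "v \<in> S" "w \<in> S" "J v = J w" "v \<noteq> w"
    with disj'[of v w] ne[of v] show False by simp
  qed
  ultimately have "countable S" by (rule countable_image_inj_on)
  then show ?thesis by (simp add: S_def)
qed

text \<open>Every slice in direction \<open>n\<close> is countable, hence null, and Tonelli
  concludes. The union over the thresholds 1/(m+1) supplies the Borel measurability that Tonelli
  requires.\<close>

lemma null_ambiguous:
  assumes "compact A" and fr: "frame e n"
  shows "{x. \<exists>p q. nearest A x p \<and> nearest A x q \<and> n \<bullet> p < n \<bullet> q} \<in> null_sets lborel"
    (is "?N \<in> _")
proof -
  have "?N = (\<Union>m. {x. \<exists>p q. nearest A x p \<and> nearest A x q \<and> inverse (real (Suc m)) \<le> n \<bullet> q - n \<bullet> p})"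
    (is "_ = ?U")
  proof (intro equalityI subsetI)
    fix x assume "x \<in> ?N"
    then obtain p q where pq: "nearest A x p" "nearest A x q" "n \<bullet> q - n \<bullet> p > 0" by auto
    from reals_Archimedean[OF pq(3)] obtain m where "inverse (real (Suc m)) \<le> n \<bullet> q - n \<bullet> p"
      using less_imp_le by blast
    with pq show "x \<in> ?U" by blast
  next
    fix x assume "x \<in> ?U"
    then obtain m p q where pq: "nearest A x p" "nearest A x q" "inverse (real (Suc m)) \<le> n \<bullet> q - n \<bullet> p"
      by blast
    moreover have "0 < inverse (real (Suc m))" by simp
    ultimately have "n \<bullet> p < n \<bullet> q" by linarith
    with pq show "x \<in> ?N" by blast
  qed
  moreover have "?U \<in> sets borel"
    by (intro sets.countable_UN image_subsetI borel_closed closed_ambiguous[OF \<open>compact A\<close>]) 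
  ultimately have bor: "?N \<in> sets borel" by simp
  have "emeasure lborel {v. u *\<^sub>R e + v *\<^sub>R n \<in> ?N} = 0" for u
    using countable_ambiguous_slice[OF fr, of A u] by (simp add: emeasure_lborel_countable)
  then have "emeasure lborel ?N = 0"
    by (subst emeasure_frame_slices[OF fr bor]) simp
  with bor show ?thesis by (simp add: null_sets_def)
qed

text \<open>Distinct points differ in one of the two coordinates of a frame, so the exceptional set
  is covered by two null sets, one for each direction.\<close>

lemma AE_nearest_unique:
  fixes A :: "(real^2) set"
  assumes "compact A"
  shows "AE x in lborel. \<forall>p q. nearest A x p \<longrightarrow> nearest A x q \<longrightarrow> p = q"
proof -
  define e :: "real^2" where "e = axis 1 1"
  have "norm e = 1" by (simp add: e_def)
  then obtain n where fr: "frame e n" by (rule frame_exists)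
  have "AE x in lborel. \<not> (\<exists>p q. nearest A x p \<and> nearest A x q \<and> n \<bullet> p < n \<bullet> q)"
    using AE_not_in[OF null_ambiguous[OF assms fr]] unfolding mem_Collect_eq .
  moreover have "AE x in lborel. \<not> (\<exists>p q. nearest A x p \<and> nearest A x q \<and> e \<bullet> p < e \<bullet> q)"
    using AE_not_in[OF null_ambiguous[OF assms frame_swap[OF fr]]] unfolding mem_Collect_eq .
  ultimately show ?thesis
  proof eventually_elim
    case (elim x)
    have "p = q" if "nearest A x p" "nearest A x q" for p q
    proof -
      have "\<not> e \<bullet> p < e \<bullet> q" "\<not> e \<bullet> q < e \<bullet> p" "\<not> n \<bullet> p < n \<bullet> q" "\<not> n \<bullet> q < n \<bullet> p"
        using elim that by blast+
      then have eq: "e \<bullet> p = e \<bullet> q" "n \<bullet> p = n \<bullet> q" by simp_all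
      have "p = (e \<bullet> p) *\<^sub>R e + (n \<bullet> p) *\<^sub>R n" by (rule frame_expand[OF fr, symmetric])
      also have "\<dots> = (e \<bullet> q) *\<^sub>R e + (n \<bullet> q) *\<^sub>R n" by (simp only: eq)
      also have "\<dots> = q" by (rule frame_expand[OF fr])
      finally show ?thesis .
    qed
    then show ?case by iprover
  qed
qed

text \<open>The part of \<open>A\<close> outside the ball around \<open>p\<close> is compact and, by
  uniqueness, strictly farther from \<open>x\<close> than \<open>p\<close> is. Moving
  \<open>x\<close> by less than half of this gap changes each of the two distances by less than half
  of it, so the order is preserved.\<close>

lemma nearest_continuous:
  fixes A :: "'a::heine_borel set"
  assumes "compact A" "nearest A x p" and uniq: "\<And>q. nearest A x q \<Longrightarrow> q = p" and "0 < r"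
  obtains d where "0 < d" "\<And>y q. dist y x < d \<Longrightarrow> nearest A y q \<Longrightarrow> dist q p < r"
proof (cases "A - ball p r = {}")
  case True
  then have "dist q p < r" if "nearest A y q" for y q
    using that by (auto simp: nearest_def dist_commute subset_eq)
  then show ?thesis using that[of 1] by auto
next
  case False
  define B where "B = A - ball p r"
  have "compact B" "B \<noteq> {}" using assms(1) False by (auto simp: B_def compact_diff)
  then obtain b where b: "nearest B x b" by (meson nearest_exists)
  then have "b \<in> A" "b \<noteq> p" using \<open>0 < r\<close> by (auto simp: nearest_def B_def)
  then have "dist x p < dist x b"
    using uniq[of b] nearest_le[OF assms(2), of b] assms(2) by (force simp: nearest_def)
  define d where "d = (dist x b - dist x p) / 2"
  show ?thesis
  proof (rule that[of d])
    show "0 < d" using \<open>dist x p < dist x b\<close> by (simp add: d_def)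
    fix y q assume yq: "dist y x < d" "nearest A y q"
    show "dist q p < r"
    proof (rule ccontr)
      assume "\<not> dist q p < r"
      then have "q \<in> B" using yq(2) by (auto simp: B_def nearest_def dist_commute)
      then have "dist x b \<le> dist x q" by (rule nearest_le[OF b])
      moreover have "dist y q \<le> dist y p"
        using nearest_le[OF yq(2)] assms(2) by (auto simp: nearest_def)
      moreover have "dist x q \<le> dist y x + dist y q" by (rule dist_triangle3)
      moreover have "dist y p \<le> dist y x + dist x p" by (rule dist_triangle)
      ultimately show False using yq(1) by (simp add: d_def)
    qed
  qed
qed

text \<open>Convexity of the norm: \<open>sgn a\<close> is a subgradient at
  \<open>a\<close>.\<close>

lemma norm_diff_le_sgn_inner:
  fixes a b :: "'a::real_inner"
  shows "norm a - norm b \<le> sgn a \<bullet> (a - b)"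
proof (cases "a = 0")
  case False
  have "sgn a \<bullet> a = norm a"
    using False by (simp add: sgn_div_norm dot_square_norm power2_eq_square)
  moreover have "sgn a \<bullet> b \<le> norm b"
    using norm_cauchy_schwarz[of "sgn a" b] False by (simp add: norm_sgn)
  ultimately show ?thesis by (simp add: inner_diff_right)
qed simp

text \<open>A sandwich between two competitors. Using \<open>p\<close> as a competitor at
  \<open>y\<close> bounds the increment of the distance above by the inner product of
  \<open>y - x\<close> with \<open>sgn (y - p)\<close>; using a nearest point \<open>q\<close> of
  \<open>y\<close> as a competitor at \<open>x\<close> bounds it below with
  \<open>sgn (x - q)\<close>. Both unit vectors tend to \<open>sgn (x - p)\<close> as
  \<open>y\<close> tends to \<open>x\<close>, because \<open>q\<close> tends to \<open>p\<close> and
  \<open>sgn\<close> is continuous away from 0.\<close>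

lemma GDERIV_infdist:
  fixes A :: "'a::euclidean_space set"
  assumes "compact A" and p: "nearest A x p" and uniq: "\<And>q. nearest A x q \<Longrightarrow> q = p" and "x \<notin> A"
  shows "GDERIV (\<lambda>y. infdist y A) x :> sgn (x - p)"
  unfolding gderiv_def has_derivative_at_alt
proof (intro conjI allI impI)
  show "bounded_linear (\<lambda>h. h \<bullet> sgn (x - p))" by (rule bounded_linear_inner_left)
  fix c :: real assume "0 < c"
  have "x \<noteq> p" "A \<noteq> {}" using p \<open>x \<notin> A\<close> by (auto simp: nearest_def)
  then have "continuous (at (x - p)) sgn" by (intro continuous_intros) auto
  then obtain r where r: "0 < r" "\<And>z. dist z (x - p) < r \<Longrightarrow> dist (sgn z) (sgn (x - p)) < c"
    using \<open>0 < c\<close> unfolding continuous_at_eps_delta by blast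
  obtain d where d: "0 < d" "\<And>y q. dist y x < d \<Longrightarrow> nearest A y q \<Longrightarrow> dist q p < r"
    using nearest_continuous[OF assms(1) p uniq \<open>0 < r\<close>] by blast
  show "\<exists>d>0. \<forall>y. norm (y - x) < d \<longrightarrow>
      norm (infdist y A - infdist x A - (y - x) \<bullet> sgn (x - p)) \<le> c * norm (y - x)"
  proof (intro exI[of _ "min d r"] conjI allI impI)
    fix y assume y: "norm (y - x) < min d r"
    obtain q where q: "nearest A y q" using nearest_exists assms(1) \<open>A \<noteq> {}\<close> by blast
    have err: "\<bar>(y - x) \<bullet> (sgn z - sgn (x - p))\<bar> \<le> c * norm (y - x)" if "dist z (x - p) < r" for z
      using Cauchy_Schwarz_ineq2[of "y - x" "sgn z - sgn (x - p)"] r(2)[OF that]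
        mult_left_mono[of "dist (sgn z) (sgn (x - p))" c "norm (y - x)"]
      by (simp add: dist_norm mult.commute)
    have "infdist y A \<le> norm (y - p)" "infdist x A = norm (x - p)"
      using p by (auto simp: nearest_def dist_norm infdist_le[of p A y, unfolded dist_norm])
    then have up: "infdist y A - infdist x A \<le> (y - x) \<bullet> sgn (y - p)"
      using norm_diff_le_sgn_inner[of "y - p" "x - p"] by (simp add: inner_commute)
    have "infdist x A \<le> norm (x - q)" "infdist y A = norm (y - q)"
      using q by (auto simp: nearest_def dist_norm infdist_le[of q A x, unfolded dist_norm])
    then have lo: "infdist y A - infdist x A \<ge> (y - x) \<bullet> sgn (x - q)"
      using norm_diff_le_sgn_inner[of "x - q" "y - q"] inner_minus_left[of "x - y" "sgn (x - q)"]
      by (simp add: inner_commute)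
    have "dist (y - p) (x - p) < r" using y by (simp add: dist_norm)
    moreover have "dist (x - q) (x - p) < r"
      using d(2)[OF _ q] y by (simp add: dist_norm norm_minus_commute)
    ultimately show "norm (infdist y A - infdist x A - (y - x) \<bullet> sgn (x - p)) \<le> c * norm (y - x)"
      using up lo err[of "y - p"] err[of "x - q"] by (simp add: inner_diff_right abs_le_iff)
  qed (use \<open>0 < d\<close> \<open>0 < r\<close> in auto)
qed

lemma gradient_eqI:
  assumes "GDERIV f x :> D"
  shows "gradient f x = D"
  unfolding gradient_def
proof (rule the_equality)
  show "GDERIV f x :> D" by fact
  fix D' assume "GDERIV f x :> D'"
  with assms have "(\<lambda>h. h \<bullet> D') = (\<lambda>h. h \<bullet> D)"
    unfolding gderiv_def using has_derivative_unique by blast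
  then have "h \<bullet> D' = h \<bullet> D" for h by (rule fun_cong)
  then show "D' = D" using vector_eq_ldot by blast
qed

lemma AE_norm_gradient_infdist:
  fixes A :: "(real^2) set"
  assumes "compact A" "A \<noteq> {}"
  shows "AE x in lborel. x \<notin> A \<longrightarrow> norm (gradient (\<lambda>y. infdist y A) x) = 1"
  using AE_nearest_unique[OF assms(1)]
proof eventually_elim
  case (elim x)
  obtain p where p: "nearest A x p" using nearest_exists assms by blast
  show ?case
  proof
    assume "x \<notin> A"
    have "GDERIV (\<lambda>y. infdist y A) x :> sgn (x - p)"
      using elim p by (intro GDERIV_infdist[OF assms(1) p _ \<open>x \<notin> A\<close>]) blast
    then have "gradient (\<lambda>y. infdist y A) x = sgn (x - p)" by (rule gradient_eqI)
    moreover have "x \<noteq> p" using p \<open>x \<notin> A\<close> by (auto simp: nearest_def)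
    ultimately show "norm (gradient (\<lambda>y. infdist y A) x) = 1" by (simp add: norm_sgn)
  qed
qed

subsection \<open>Tubes around sets close to a line\<close>

text \<open>A condition on chords, so it passes to subsets and mentions no graph function. For a
  frame it makes the projection to the \<open>e\<close>-axis injective: the set is an
  \<epsilon>-Lipschitz graph over its projection.\<close>

definition cone_set :: "real \<Rightarrow> real^2 \<Rightarrow> real^2 \<Rightarrow> (real^2) set \<Rightarrow> bool" where
  "cone_set \<epsilon> e n P \<longleftrightarrow> (\<forall>p\<in>P. \<forall>q\<in>P. \<bar>n \<bullet> (p - q)\<bar> \<le> \<epsilon> * \<bar>e \<bullet> (p - q)\<bar>)"

lemma cone_set_subset: "cone_set \<epsilon> e n P \<Longrightarrow> Q \<subseteq> P \<Longrightarrow> cone_set \<epsilon> e n Q"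
  by (auto simp: cone_set_def)

lemma cone_set_dist_le:
  assumes "frame e n" "cone_set \<epsilon> e n P" "p \<in> P" "q \<in> P"
  shows "dist p q \<le> (1 + \<epsilon>) * \<bar>e \<bullet> p - e \<bullet> q\<bar>"
proof -
  have "dist p q \<le> \<bar>e \<bullet> (p - q)\<bar> + \<bar>n \<bullet> (p - q)\<bar>"
    unfolding dist_norm by (rule frame_norm_le[OF assms(1)])
  also have "\<bar>n \<bullet> (p - q)\<bar> \<le> \<epsilon> * \<bar>e \<bullet> (p - q)\<bar>"
    using assms by (simp add: cone_set_def)
  finally show ?thesis by (simp add: algebra_simps inner_diff_right)
qed

text \<open>Phrased through points of \<open>P\<close> because \<open>infdist\<close> to the empty
  set is 0 by convention; in this form an empty piece has an empty tube.\<close>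

definition tube :: "'a::metric_space set \<Rightarrow> real \<Rightarrow> 'a set" where
  "tube P t = {x. \<exists>p\<in>P. dist x p \<le> t}"

lemma tube_eq_infdist:
  fixes P :: "'a::heine_borel set"
  assumes "compact P" "P \<noteq> {}"
  shows "tube P t = {x. infdist x P \<le> t}"
proof (intro equalityI subsetI)
  fix x assume "x \<in> {x. infdist x P \<le> t}"
  moreover obtain p where "nearest P x p" by (rule nearest_exists[OF assms])
  ultimately have "p \<in> P" "dist x p \<le> t" by (simp_all add: nearest_def)
  then show "x \<in> tube P t" unfolding tube_def by blast
qed (auto simp: tube_def intro: infdist_le2)

lemma compact_tube:
  fixes P :: "'a::heine_borel set"
  assumes "compact P"
  shows "compact (tube P t)"
proof (cases "P = {}")
  case False
  have "closed (tube P t)"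
    unfolding tube_eq_infdist[OF assms False] by (intro closed_Collect_le continuous_intros)
  moreover have "bounded (tube P t)"
  proof -
    obtain a r where "\<forall>p\<in>P. dist a p \<le> r"
      using compact_imp_bounded[OF assms] by (auto simp: bounded_def)
    then have "dist a x \<le> r + t" if "x \<in> tube P t" for x
      using that dist_triangle_less_add by (auto simp: tube_def) (smt (verit) dist_commute dist_triangle)
    then show ?thesis unfolding bounded_def by blast
  qed
  ultimately show ?thesis by (simp add: compact_eq_bounded_closed)
qed (simp add: tube_def)

lemma tube_mono: "P \<subseteq> Q \<Longrightarrow> s \<le> t \<Longrightarrow> tube P s \<subseteq> tube Q t"
  by (force simp: tube_def)

text \<open>By outer regularity \<open>K\<close> lies in an open set of almost the same measure, and
  by compactness that open set contains a whole tube. It is applied to projections of pieces,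
  compact subsets of the line about whose shape nothing else is known.\<close>

lemma emeasure_tube_limit:
  fixes K :: "'a::euclidean_space set"
  assumes "compact K" "0 < \<eta>"
  obtains \<tau> where "0 < \<tau>"
    "\<And>t. t \<le> \<tau> \<Longrightarrow> emeasure lborel (tube K t) \<le> emeasure lborel K + ennreal \<eta>"
proof (cases "K = {}")
  case True
  then show ?thesis using that[of 1] by (simp add: tube_def)
next
  case False
  have K: "K \<in> sets borel" using assms(1) by (simp add: borel_compact)
  obtain U where U: "open U" "K \<subseteq> U" "emeasure lborel (U - K) < ennreal \<eta>"
    using outer_regular_lborel[OF K, of "\<eta>"] assms(2) by auto
  obtain \<tau> where \<tau>: "0 < \<tau>" "{x. infdist x K \<le> \<tau>} \<subseteq> U"
    by (rule compact_in_open_separated[OF False assms(1) U(1,2)])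
  show ?thesis
  proof (rule that[OF \<tau>(1)])
    fix t assume "t \<le> \<tau>"
    then have "tube K t \<subseteq> U"
      using \<tau>(2) tube_mono[OF order_refl, of t \<tau> K] by (auto simp: tube_eq_infdist[OF assms(1) False])
    then have "emeasure lborel (tube K t) \<le> emeasure lborel U"
      using U(1) by (intro emeasure_mono) auto
    also have "\<dots> = emeasure lborel (K \<union> (U - K))" using U(2) by (simp add: Un_absorb1)
    also have "\<dots> \<le> emeasure lborel K + emeasure lborel (U - K)"
      using K U(1) by (intro emeasure_subadditive) auto
    finally show "emeasure lborel (tube K t) \<le> emeasure lborel K + ennreal \<eta>"
      using U(3) by (meson add_left_mono less_imp_le order_trans)
  qed
qed

text \<open>The interval from the infimum to the supremum. It serves as a measurable hull for sets
  that may fail to be measurable, such as projections of arbitrary covering sets.\<close>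

lemma real_set_in_interval:
  fixes S :: "real set"
  assumes "bounded S"
  obtains I where "I \<in> sets borel" "S \<subseteq> I" "emeasure lborel I \<le> ennreal (diameter S)"
proof (cases "S = {}")
  case True
  then show ?thesis using that[of "{}"] by simp
next
  case False
  have bdd: "bdd_above S" "bdd_below S" using assms by (auto simp: bounded_imp_bdd_above bounded_imp_bdd_below)
  have "x - diameter S \<le> y" if "x \<in> S" "y \<in> S" for x y
    using diameter_bounded_bound[OF assms that] by (simp add: dist_real_def)
  then have "x - diameter S \<le> Inf S" if "x \<in> S" for x
    using that False by (intro cInf_greatest) auto
  then have "Sup S \<le> Inf S + diameter S"
    using False by (intro cSup_least) (auto simp: algebra_simps)
  moreover have "Inf S \<le> Sup S" using bdd False by (metis cInf_le_cSup)
  ultimately have "emeasure lborel {Inf S..Sup S} \<le> ennreal (diameter S)"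
    by (simp add: ennreal_leI)
  moreover have "S \<subseteq> {Inf S..Sup S}" using bdd by (auto intro: cInf_lower cSup_upper)
  ultimately show ?thesis by (intro that[of "{Inf S..Sup S}"]) auto
qed

text \<open>Orthogonal projection to a line is 1-Lipschitz and so does not increase diameters; on
  the line, diameter dominates measure. This is the source of the lower bound for length.\<close>

lemma emeasure_le_diameter_cover:
  fixes e :: "'a::euclidean_space"
  assumes "norm e = 1" "P \<subseteq> (\<Union>i. C i)" "\<And>i::nat. bounded (C i)"
  shows "emeasure lborel ((\<bullet>) e ` P) \<le> (\<Sum>i. ennreal (diameter (C i)))"
proof -
  have "\<exists>I. I \<in> sets borel \<and> (\<bullet>) e ` C i \<subseteq> I \<and> emeasure lborel I \<le> ennreal (diameter (C i))" for i
  proof -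
    have bdd: "bounded ((\<bullet>) e ` C i)"
      by (rule bounded_linear_image[OF assms(3) bounded_linear_inner_right])
    have "diameter ((\<bullet>) e ` C i) \<le> diameter (C i)"
    proof (rule diameter_le)
      fix x y assume "x \<in> (\<bullet>) e ` C i" "y \<in> (\<bullet>) e ` C i"
      then obtain p q where pq: "p \<in> C i" "q \<in> C i" "x = e \<bullet> p" "y = e \<bullet> q" by auto
      have "norm (x - y) \<le> norm e * norm (p - q)"
        using Cauchy_Schwarz_ineq2[of e "p - q"] pq by (simp add: inner_diff_right)
      also have "\<dots> \<le> diameter (C i)"
        using diameter_bounded_bound[OF assms(3) pq(1,2)] assms(1) by (simp add: dist_norm)
      finally show "norm (x - y) \<le> diameter (C i)" .
    qed (simp add: diameter_ge_0[OF assms(3)])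
    then have le: "ennreal (diameter ((\<bullet>) e ` C i)) \<le> ennreal (diameter (C i))" by (rule ennreal_leI)
    obtain I where "I \<in> sets borel" "(\<bullet>) e ` C i \<subseteq> I" "emeasure lborel I \<le> ennreal (diameter ((\<bullet>) e ` C i))"
      by (rule real_set_in_interval[OF bdd])
    with le show ?thesis by (meson order_trans)
  qed
  then obtain I where I: "\<And>i. I i \<in> sets borel" "\<And>i. (\<bullet>) e ` C i \<subseteq> I i"
      "\<And>i. emeasure lborel (I i) \<le> ennreal (diameter (C i))"
    by metis
  have "emeasure lborel ((\<bullet>) e ` P) \<le> emeasure lborel (\<Union>i. I i)"
    using assms(2) I(1,2) by (intro emeasure_mono) (auto, blast)
  also have "\<dots> \<le> (\<Sum>i. emeasure lborel (I i))"
    using I(1) by (intro emeasure_subadditive_countably) auto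
  also have "\<dots> \<le> (\<Sum>i. ennreal (diameter (C i)))"
    by (intro suminf_le I(3)) auto
  finally show ?thesis .
qed

text \<open>Over each point of the projection, the slice of the tube contains the segment of length
  \<open>2 * t\<close> centred at a point of \<open>P\<close>.\<close>

lemma emeasure_tube_ge:
  assumes fr: "frame e n" and "compact P" "0 \<le> t"
  shows "emeasure lborel ((\<bullet>) e ` P) * ennreal (2 * t) \<le> emeasure lborel (tube P t)"
proof -
  have K: "compact ((\<bullet>) e ` P)"
    by (intro compact_continuous_image continuous_intros assms)
  have "emeasure lborel ((\<bullet>) e ` P) * ennreal (2 * t) = (\<integral>\<^sup>+u. ennreal (2 * t) * indicator ((\<bullet>) e ` P) u \<partial>lborel)"
    using K by (subst nn_integral_cmult_indicator) (auto simp: borel_compact mult.commute)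
  also have "\<dots> \<le> (\<integral>\<^sup>+u. emeasure lborel {v. u *\<^sub>R e + v *\<^sub>R n \<in> tube P t} \<partial>lborel)"
  proof (rule nn_integral_mono)
    fix u
    show "ennreal (2 * t) * indicator ((\<bullet>) e ` P) u \<le> emeasure lborel {v. u *\<^sub>R e + v *\<^sub>R n \<in> tube P t}"
    proof (cases "u \<in> (\<bullet>) e ` P")
      case True
      then obtain p where p: "p \<in> P" "u = e \<bullet> p" by auto
      have "dist (u *\<^sub>R e + v *\<^sub>R n) p = \<bar>v - n \<bullet> p\<bar>" for v
      proof -
        have "u *\<^sub>R e + v *\<^sub>R n - p = u *\<^sub>R e + v *\<^sub>R n - ((e \<bullet> p) *\<^sub>R e + (n \<bullet> p) *\<^sub>R n)"
          by (simp only: frame_expand[OF fr])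
        then have "u *\<^sub>R e + v *\<^sub>R n - p = (v - n \<bullet> p) *\<^sub>R n"
          by (simp add: p algebra_simps)
        then show ?thesis using fr by (simp add: dist_norm frame_def)
      qed
      then have "{n \<bullet> p - t..n \<bullet> p + t} \<subseteq> {v. u *\<^sub>R e + v *\<^sub>R n \<in> tube P t}"
        using p(1) by (auto simp: tube_def intro!: bexI[of _ p])
      moreover have "{v. u *\<^sub>R e + v *\<^sub>R n \<in> tube P t} \<in> sets lborel"
      proof -
        have "closed ((\<lambda>v. u *\<^sub>R e + v *\<^sub>R n) -` tube P t)"
          using compact_tube[OF \<open>compact P\<close>, of t]
          by (intro closed_vimage continuous_intros) (simp add: compact_imp_closed)
        then show ?thesis by (simp add: vimage_def)
      qed
      ultimately have "emeasure lborel {n \<bullet> p - t..n \<bullet> p + t} \<le> emeasure lborel {v. u *\<^sub>R e + v *\<^sub>R n \<in> tube P t}"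
        by (rule emeasure_mono)
      then show ?thesis using True \<open>0 \<le> t\<close> by simp
    qed simp
  qed
  also have "\<dots> = emeasure lborel (tube P t)"
    using compact_tube[OF \<open>compact P\<close>, of t]
    by (subst emeasure_frame_slices[OF fr, symmetric]) (auto simp: borel_compact)
  finally show ?thesis .
qed

text \<open>Points of \<open>P\<close> that contribute to the slice at \<open>u\<close> have
  \<open>e\<close>-coordinates within \<open>t\<close> of \<open>u\<close>, hence within
  \<open>2 * t\<close> of each other, and the cone condition keeps their
  \<open>n\<close>-coordinates within \<open>2 * \<epsilon> * t\<close>. Adding \<open>t\<close> at
  both ends bounds the slice by \<open>2 * (1 + \<epsilon>) * t\<close>. Nonempty slices occur only
  for \<open>u\<close> within \<open>t\<close> of the projection.\<close>

lemma emeasure_tube_le: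
  assumes fr: "frame e n" and P: "compact P" "cone_set \<epsilon> e n P" and "0 \<le> t" "0 \<le> \<epsilon>"
  shows "emeasure lborel (tube P t) \<le> emeasure lborel (tube ((\<bullet>) e ` P) t) * ennreal (2 * (1 + \<epsilon>) * t)"
proof -
  have K: "compact (tube ((\<bullet>) e ` P) t)"
    by (intro compact_tube compact_continuous_image continuous_intros P)
  have "emeasure lborel (tube P t) = (\<integral>\<^sup>+u. emeasure lborel {v. u *\<^sub>R e + v *\<^sub>R n \<in> tube P t} \<partial>lborel)"
    using compact_tube[OF \<open>compact P\<close>, of t]
    by (intro emeasure_frame_slices[OF fr]) (auto simp: borel_compact)
  also have "\<dots> \<le> (\<integral>\<^sup>+u. ennreal (2 * (1 + \<epsilon>) * t) * indicator (tube ((\<bullet>) e ` P) t) u \<partial>lborel)"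
  proof (rule nn_integral_mono)
    fix u
    define S where "S = {v. u *\<^sub>R e + v *\<^sub>R n \<in> tube P t}"
    have pt: "\<exists>p\<in>P. \<bar>u - e \<bullet> p\<bar> \<le> t \<and> \<bar>v - n \<bullet> p\<bar> \<le> t" if v: "v \<in> S" for v
    proof -
      obtain p where p: "p \<in> P" "norm (u *\<^sub>R e + v *\<^sub>R n - p) \<le> t"
        using v unfolding S_def tube_def dist_norm by blast
      moreover have "\<bar>u - e \<bullet> p\<bar> \<le> norm (u *\<^sub>R e + v *\<^sub>R n - p)" "\<bar>v - n \<bullet> p\<bar> \<le> norm (u *\<^sub>R e + v *\<^sub>R n - p)"
        using frame_inner_le[OF fr, of "u *\<^sub>R e + v *\<^sub>R n - p"] fr by (simp_all add: inner_diff_right)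
      ultimately show ?thesis by (intro bexI[of _ p]) auto
    qed
    show "emeasure lborel {v. u *\<^sub>R e + v *\<^sub>R n \<in> tube P t}
        \<le> ennreal (2 * (1 + \<epsilon>) * t) * indicator (tube ((\<bullet>) e ` P) t) u"
    proof (cases "u \<in> tube ((\<bullet>) e ` P) t")
      case True
      have dS: "norm (v - w) \<le> 2 * (1 + \<epsilon>) * t" if vw: "v \<in> S" "w \<in> S" for v w
      proof -
        obtain p where p: "p \<in> P" "\<bar>u - e \<bullet> p\<bar> \<le> t" "\<bar>v - n \<bullet> p\<bar> \<le> t" using pt[OF vw(1)] by auto
        obtain q where q: "q \<in> P" "\<bar>u - e \<bullet> q\<bar> \<le> t" "\<bar>w - n \<bullet> q\<bar> \<le> t" using pt[OF vw(2)] by auto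
        have "\<bar>n \<bullet> p - n \<bullet> q\<bar> \<le> \<epsilon> * \<bar>e \<bullet> p - e \<bullet> q\<bar>"
          using P(2) p(1) q(1) by (auto simp: cone_set_def inner_diff_right)
        also have "\<dots> \<le> \<epsilon> * (2 * t)" using p q \<open>0 \<le> \<epsilon>\<close> by (intro mult_left_mono) auto
        finally have "\<bar>v - w\<bar> \<le> \<epsilon> * (2 * t) + 2 * t" using p q by linarith
        then show ?thesis by (simp add: algebra_simps)
      qed
      have bS: "bounded S"
        unfolding bounded_def dist_norm using dS by (cases "S = {}") (simp, blast)
      have nn: "0 \<le> 2 * (1 + \<epsilon>) * t" using \<open>0 \<le> t\<close> \<open>0 \<le> \<epsilon>\<close> by simp
      have "diameter S \<le> 2 * (1 + \<epsilon>) * t"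
        using dS nn by (intro diameter_le) auto
      moreover obtain I where I: "I \<in> sets borel" "S \<subseteq> I" "emeasure lborel I \<le> ennreal (diameter S)"
        by (rule real_set_in_interval[OF bS])
      moreover have "emeasure lborel S \<le> emeasure lborel I" using I by (intro emeasure_mono) auto
      ultimately have "emeasure lborel S \<le> ennreal (2 * (1 + \<epsilon>) * t)"
        by (meson ennreal_leI order_trans)
      then show ?thesis using True by (simp add: S_def)
    next
      case False
      then have "S = {}" using pt by (force simp: tube_def dist_real_def)
      then show ?thesis by (simp add: S_def)
    qed
  qed
  also have "\<dots> = emeasure lborel (tube ((\<bullet>) e ` P) t) * ennreal (2 * (1 + \<epsilon>) * t)"
    using K by (subst nn_integral_cmult_indicator) (auto simp: borel_compact mult.commute)
  finally show ?thesis .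
qed

subsection \<open>Hausdorff measure of sets close to a line\<close>

text \<open>Covers in the definition are infinite sequences, so a finite one is padded with empty
  sets, whose diameter is 0.\<close>

lemma hausdorff1_delta_le_finite_cover:
  assumes "finite J" "S \<subseteq> (\<Union>j\<in>J. D j)" "0 \<le> \<delta>"
    and D: "\<And>j. j \<in> J \<Longrightarrow> bounded (D j) \<and> diameter (D j) \<le> \<delta>"
  shows "hausdorff1_delta \<delta> S \<le> (\<Sum>j\<in>J. ennreal (diameter (D j)))"
proof -
  obtain b where b: "bij_betw b {..<card J} J"
    using ex_bij_betw_nat_finite[OF assms(1)] by (auto simp: lessThan_atLeast0)
  define C where "C i = (if i < card J then D (b i) else {})" for i
  have bJ: "b i \<in> J" if "i < card J" for i using b that by (auto simp: bij_betw_def)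
  have "S \<subseteq> (\<Union>i. C i)"
  proof
    fix x assume "x \<in> S"
    then obtain j where "j \<in> J" "x \<in> D j" using assms(2) by blast
    moreover then obtain i where "i < card J" "b i = j" using b by (metis bij_betw_iff_bijections lessThan_iff)
    ultimately show "x \<in> (\<Union>i. C i)" by (auto simp: C_def intro!: exI[of _ i])
  qed
  moreover have "bounded (C i) \<and> diameter (C i) \<le> \<delta>" for i
    using D bJ assms(3) by (auto simp: C_def)
  ultimately have "hausdorff1_delta \<delta> S \<le> (\<Sum>i. ennreal (diameter (C i)))"
    unfolding hausdorff1_delta_def by (intro INF_lower) auto
  also have "\<dots> = (\<Sum>i<card J. ennreal (diameter (C i)))"
    by (rule suminf_finite) (auto simp: C_def)
  also have "\<dots> = (\<Sum>i<card J. ennreal (diameter (D (b i))))"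
    by (rule sum.cong) (auto simp: C_def)
  also have "\<dots> = (\<Sum>j\<in>J. ennreal (diameter (D j)))"
    by (rule sum.reindex_bij_betw[OF b])
  finally show ?thesis .
qed

text \<open>The \<open>e\<close>-axis is cut into cells of length \<open>h\<close>, and
  \<open>P\<close> into the parts above them. Each part has diameter at most (1 + \<epsilon>) h, and
  the cells that are used lie in the \<open>h\<close>-tube of the projection, whose measure exceeds
  that of the projection by at most \<eta>.\<close>

lemma cone_set_finite_cover:
  assumes fr: "frame e n" and P: "compact P" "cone_set \<epsilon> e n P" and "0 \<le> \<epsilon>" "0 < \<delta>" "0 < \<eta>"
  obtains J :: "int set" and D where "finite J" "P \<subseteq> (\<Union>j\<in>J. D j)"
    "\<And>j. bounded (D j) \<and> diameter (D j) \<le> \<delta>"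
    "(\<Sum>j\<in>J. ennreal (diameter (D j))) \<le> ennreal (1 + \<epsilon>) * (emeasure lborel ((\<bullet>) e ` P) + ennreal \<eta>)"
proof -
  define K where "K = (\<bullet>) e ` P"
  have K: "compact K"
    unfolding K_def by (intro compact_continuous_image continuous_intros P)
  obtain \<tau> where \<tau>: "0 < \<tau>" "\<And>t. t \<le> \<tau> \<Longrightarrow> emeasure lborel (tube K t) \<le> emeasure lborel K + ennreal \<eta>"
    using emeasure_tube_limit[OF K \<open>0 < \<eta>\<close>] by metis
  \<comment> \<open>The bound \<tau> keeps the used cells in a tube of controlled measure; the other
    bound makes (1 + \<epsilon>) h at most \<delta>.\<close>
  define h where "h = min \<tau> (\<delta> / (1 + \<epsilon>))"
  have h: "0 < h" "h \<le> \<tau>" "(1 + \<epsilon>) * h \<le> \<delta>"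
  proof -
    have "h \<le> \<delta> / (1 + \<epsilon>)" by (simp add: h_def)
    then show "(1 + \<epsilon>) * h \<le> \<delta>" using assms(4) by (simp add: pos_le_divide_eq mult.commute)
  qed (use \<tau>(1) assms(4,5) in \<open>auto simp: h_def\<close>)
  define J where "J = (\<lambda>u. \<lfloor>u / h\<rfloor>) ` K"
  define D where "D j = {p \<in> P. \<lfloor>e \<bullet> p / h\<rfloor> = j}" for j
  have cell: "u \<in> {of_int j * h..<(of_int j + 1) * h}" if "\<lfloor>u / h\<rfloor> = j" for u j
    using that h(1) by (auto simp: floor_eq_iff field_simps)
  have "finite J"
  proof -
    obtain M where "\<forall>u\<in>K. \<bar>u\<bar> \<le> M"
      using compact_imp_bounded[OF K] by (auto simp: bounded_iff)
    then have "- M / h \<le> u / h \<and> u / h \<le> M / h" if "u \<in> K" for u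
      using that h(1) by (intro conjI divide_right_mono) (auto simp: abs_le_iff)
    then have "J \<subseteq> {\<lfloor>- M / h\<rfloor>..\<lfloor>M / h\<rfloor>}"
      unfolding J_def by (auto intro!: floor_mono simp del: minus_divide_left)
    then show ?thesis by (rule finite_subset) simp
  qed
  have bD: "bounded (D j)" for j
    by (rule bounded_subset[OF compact_imp_bounded[OF P(1)]]) (auto simp: D_def)
  have dD: "diameter (D j) \<le> (1 + \<epsilon>) * h" for j
  proof (rule diameter_le)
    fix p q assume pq: "p \<in> D j" "q \<in> D j"
    then have "\<bar>e \<bullet> p - e \<bullet> q\<bar> \<le> h"
      using cell[of "e \<bullet> p" j] cell[of "e \<bullet> q" j] by (auto simp: D_def algebra_simps)
    then have "(1 + \<epsilon>) * \<bar>e \<bullet> p - e \<bullet> q\<bar> \<le> (1 + \<epsilon>) * h" using \<open>0 \<le> \<epsilon>\<close> by simp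
    with pq show "norm (p - q) \<le> (1 + \<epsilon>) * h"
      using cone_set_dist_le[OF fr P(2), of p q] by (simp add: D_def dist_norm)
  qed (use \<open>0 \<le> \<epsilon>\<close> h(1) in simp)
  have "(\<Sum>j\<in>J. ennreal (diameter (D j))) \<le> (\<Sum>j\<in>J. ennreal (1 + \<epsilon>) * ennreal h)"
  proof (rule sum_mono)
    fix j
    have "ennreal (diameter (D j)) \<le> ennreal ((1 + \<epsilon>) * h)" by (rule ennreal_leI[OF dD])
    also have "\<dots> = ennreal (1 + \<epsilon>) * ennreal h" using \<open>0 \<le> \<epsilon>\<close> h(1) by (intro ennreal_mult) auto
    finally show "ennreal (diameter (D j)) \<le> ennreal (1 + \<epsilon>) * ennreal h" .
  qed
  also have "\<dots> = ennreal (1 + \<epsilon>) * (\<Sum>j\<in>J. emeasure lborel {of_int j * h..<(of_int j + 1) * h})"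
    unfolding sum_distrib_left[symmetric] using h(1) by (simp add: algebra_simps)
  \<comment> \<open>Half-open cells are disjoint, so their total length is the measure of their
    union.\<close>
  also have "(\<Sum>j\<in>J. emeasure lborel {of_int j * h..<(of_int j + 1) * h})
      = emeasure lborel (\<Union>j\<in>J. {of_int j * h..<(of_int j + 1) * h})"
  proof (rule sum_emeasure[OF _ _ \<open>finite J\<close>])
    have "{of_int i * h..<(of_int i + 1) * h} \<inter> {of_int j * h..<(of_int j + 1) * h} = {}" if "i < j" for i j
    proof -
      have "(of_int i + 1) * h \<le> of_int j * h" using that h(1) by (intro mult_right_mono) linarith+
      then show ?thesis by auto
    qed
    then show "disjoint_family_on (\<lambda>j. {of_int j * h..<(of_int j + 1) * h}) J"
      unfolding disjoint_family_on_def by (metis inf_commute linorder_neqE)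
  qed auto
  also have "\<dots> \<le> emeasure lborel (tube K h)"
  proof (rule emeasure_mono)
    show "(\<Union>j\<in>J. {of_int j * h..<(of_int j + 1) * h}) \<subseteq> tube K h"
    proof
      fix v assume "v \<in> (\<Union>j\<in>J. {of_int j * h..<(of_int j + 1) * h})"
      then obtain u where u: "u \<in> K" "v \<in> {of_int \<lfloor>u / h\<rfloor> * h..<(of_int \<lfloor>u / h\<rfloor> + 1) * h}"
        by (auto simp: J_def)
      have "dist v u \<le> h"
        using cell[OF refl, of u] u(2) by (auto simp: dist_real_def algebra_simps)
      with u(1) show "v \<in> tube K h" unfolding tube_def by blast
    qed
    show "tube K h \<in> sets lborel" using compact_tube[OF K] by (simp add: borel_compact)
  qed
  also have "\<dots> \<le> emeasure lborel K + ennreal \<eta>" by (rule \<tau>(2)[OF h(2)])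
  finally have "(\<Sum>j\<in>J. ennreal (diameter (D j))) \<le> ennreal (1 + \<epsilon>) * (emeasure lborel ((\<bullet>) e ` P) + ennreal \<eta>)"
    by (simp add: mult_left_mono K_def)
  moreover have "P \<subseteq> (\<Union>j\<in>J. D j)" by (auto simp: J_def D_def K_def)
  moreover have "bounded (D j) \<and> diameter (D j) \<le> \<delta>" for j using bD order_trans[OF dD h(3)] by blast
  ultimately show ?thesis using that \<open>finite J\<close> by blast
qed

text \<open>At each scale \<delta> the finite covers of the pieces are merged into one cover,
  indexed by pairs of a piece and a cell. The bound does not depend on \<delta>, so it survives the
  supremum.\<close>

lemma hausdorff1_Union_cone_le:
  fixes m :: nat
  assumes fr: "\<And>i. i < m \<Longrightarrow> frame (e i) (n i)"
    and P: "\<And>i. i < m \<Longrightarrow> compact (P i)" "\<And>i. i < m \<Longrightarrow> cone_set \<epsilon> (e i) (n i) (P i)" and "0 \<le> \<epsilon>"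
  shows "hausdorff1 (\<Union>i<m. P i) \<le> ennreal (1 + \<epsilon>) * (\<Sum>i<m. emeasure lborel ((\<bullet>) (e i) ` P i))"
  unfolding hausdorff1_def
proof (rule SUP_least)
  fix \<delta> :: real assume "\<delta> \<in> {0<..}"
  then have "0 < \<delta>" by simp
  show "hausdorff1_delta \<delta> (\<Union>i<m. P i) \<le> ennreal (1 + \<epsilon>) * (\<Sum>i<m. emeasure lborel ((\<bullet>) (e i) ` P i))"
  proof (rule ennreal_le_epsilon)
    fix c :: real assume "0 < c"
    \<comment> \<open>The slack \<open>c\<close> is shared among the \<open>m\<close> pieces;
      \<open>m + 1\<close> keeps the quotient meaningful for \<open>m = 0\<close>.\<close>
    define \<eta> where "\<eta> = c / ((1 + \<epsilon>) * (real m + 1))"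
    have "0 < \<eta>" using \<open>0 < c\<close> \<open>0 \<le> \<epsilon>\<close> by (simp add: \<eta>_def)
    have "\<exists>J :: int set. \<exists>D. i < m \<longrightarrow> finite J \<and> P i \<subseteq> (\<Union>j\<in>J. D j)
        \<and> (\<forall>j. bounded (D j) \<and> diameter (D j) \<le> \<delta>)
        \<and> (\<Sum>j\<in>J. ennreal (diameter (D j))) \<le> ennreal (1 + \<epsilon>) * (emeasure lborel ((\<bullet>) (e i) ` P i) + ennreal \<eta>)" for i
    proof (cases "i < m")
      case True
      show ?thesis
        by (rule cone_set_finite_cover[OF fr P \<open>0 \<le> \<epsilon>\<close> \<open>0 < \<delta>\<close> \<open>0 < \<eta>\<close>, OF True True True]) blast
    qed simp
    then obtain J :: "nat \<Rightarrow> int set" and D where JD: "\<And>i. i < m \<Longrightarrow> finite (J i) \<and> P i \<subseteq> (\<Union>j\<in>J i. D i j)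
        \<and> (\<forall>j. bounded (D i j) \<and> diameter (D i j) \<le> \<delta>)
        \<and> (\<Sum>j\<in>J i. ennreal (diameter (D i j))) \<le> ennreal (1 + \<epsilon>) * (emeasure lborel ((\<bullet>) (e i) ` P i) + ennreal \<eta>)"
      by metis
    have "hausdorff1_delta \<delta> (\<Union>i<m. P i) \<le> (\<Sum>(i, j)\<in>Sigma {..<m} J. ennreal (diameter (D i j)))"
      unfolding case_prod_unfold
    proof (rule hausdorff1_delta_le_finite_cover)
      show "finite (Sigma {..<m} J)" using JD by auto
      show "(\<Union>i<m. P i) \<subseteq> (\<Union>w\<in>Sigma {..<m} J. D (fst w) (snd w))"
      proof
        fix x assume "x \<in> (\<Union>i<m. P i)"
        then obtain i where "i < m" "x \<in> P i" by blast
        moreover then obtain j where "j \<in> J i" "x \<in> D i j" using JD by blast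
        ultimately show "x \<in> (\<Union>w\<in>Sigma {..<m} J. D (fst w) (snd w))" by force
      qed
    qed (use JD \<open>0 < \<delta>\<close> in auto)
    also have "\<dots> = (\<Sum>i<m. \<Sum>j\<in>J i. ennreal (diameter (D i j)))"
      using JD by (intro sum.Sigma[symmetric]) auto
    also have "\<dots> \<le> (\<Sum>i<m. ennreal (1 + \<epsilon>) * (emeasure lborel ((\<bullet>) (e i) ` P i) + ennreal \<eta>))"
      using JD by (intro sum_mono) auto
    also have "\<dots> = ennreal (1 + \<epsilon>) * (\<Sum>i<m. emeasure lborel ((\<bullet>) (e i) ` P i)) + ennreal (1 + \<epsilon>) * (of_nat m * ennreal \<eta>)"
      by (simp add: sum_distrib_left[symmetric] sum.distrib distrib_left mult.left_commute)
    also have "ennreal (1 + \<epsilon>) * (of_nat m * ennreal \<eta>) = ennreal ((1 + \<epsilon>) * (real m * \<eta>))"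
      using \<open>0 \<le> \<epsilon>\<close> \<open>0 < \<eta>\<close> by (simp add: ennreal_mult ennreal_of_nat_eq_real_of_nat)
    also have "(1 + \<epsilon>) * (real m * \<eta>) = c * (real m / (real m + 1))"
      using \<open>0 \<le> \<epsilon>\<close> by (simp add: \<eta>_def)
    also have "\<dots> \<le> c"
      using \<open>0 < c\<close> by (intro mult_left_le) auto
    finally show "hausdorff1_delta \<delta> (\<Union>i<m. P i) \<le> ennreal (1 + \<epsilon>) * (\<Sum>i<m. emeasure lborel ((\<bullet>) (e i) ` P i)) + ennreal c"
      by (simp add: add_left_mono ennreal_leI)
  qed
qed

text \<open>At scale \<open>d / 2\<close> a covering set meets at most one piece, so its diameter is
  charged at most once. One sufficiently small scale is enough, since \<open>hausdorff1\<close> is a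
  supremum over scales.\<close>

lemma hausdorff1_ge_separated:
  fixes A :: "'a::euclidean_space set" and m :: nat
  assumes e: "\<And>i. i < m \<Longrightarrow> norm (e i) = 1" and sub: "\<And>i. i < m \<Longrightarrow> P i \<subseteq> A" and "0 < d"
    and sep: "\<And>i j p q. i < m \<Longrightarrow> j < m \<Longrightarrow> i \<noteq> j \<Longrightarrow> p \<in> P i \<Longrightarrow> q \<in> P j \<Longrightarrow> d \<le> dist p q"
  shows "(\<Sum>i<m. emeasure lborel ((\<bullet>) (e i) ` P i)) \<le> hausdorff1 A"
proof -
  have "(\<Sum>i<m. emeasure lborel ((\<bullet>) (e i) ` P i)) \<le> hausdorff1_delta (d / 2) A"
    unfolding hausdorff1_delta_def
  proof (rule INF_greatest)
    fix C :: "nat \<Rightarrow> 'a set"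
    assume "C \<in> {C. A \<subseteq> \<Union> (range C) \<and> (\<forall>i. bounded (C i) \<and> diameter (C i) \<le> d / 2)}"
    then have C: "A \<subseteq> (\<Union>k. C k)" "\<And>k. bounded (C k)" "\<And>k. diameter (C k) \<le> d / 2" by auto
    have "(\<Sum>i<m. emeasure lborel ((\<bullet>) (e i) ` P i)) \<le> (\<Sum>i<m. \<Sum>k. ennreal (diameter (C k \<inter> P i)))"
    proof (rule sum_mono)
      fix i assume "i \<in> {..<m}"
      then show "emeasure lborel ((\<bullet>) (e i) ` P i) \<le> (\<Sum>k. ennreal (diameter (C k \<inter> P i)))"
        using C(1,2) sub[of i] by (intro emeasure_le_diameter_cover e) (auto intro: bounded_subset)
    qed
    also have "\<dots> = (\<Sum>k. \<Sum>i<m. ennreal (diameter (C k \<inter> P i)))"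
      by (rule suminf_sum[symmetric]) simp
    also have "\<dots> \<le> (\<Sum>k. ennreal (diameter (C k)))"
    proof (intro suminf_le allI)
      fix k
      show "(\<Sum>i<m. ennreal (diameter (C k \<inter> P i))) \<le> ennreal (diameter (C k))"
      proof (cases "\<exists>i<m. C k \<inter> P i \<noteq> {}")
        case True
        then obtain i p where i: "i < m" "p \<in> C k" "p \<in> P i" by blast
        have "C k \<inter> P j = {}" if "j < m" "j \<noteq> i" for j
        proof (rule ccontr)
          assume "C k \<inter> P j \<noteq> {}"
          then obtain q where q: "q \<in> C k" "q \<in> P j" by blast
          have "d \<le> dist p q" using sep[of i j p q] i q that by auto
          moreover have "dist p q \<le> diameter (C k)" using C(2) i q by (intro diameter_bounded_bound) auto
          ultimately show False using C(3)[of k] \<open>0 < d\<close> by linarith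
        qed
        then have "(\<Sum>j<m. ennreal (diameter (C k \<inter> P j))) = (\<Sum>j\<in>{i}. ennreal (diameter (C k \<inter> P j)))"
          using i(1) by (intro sum.mono_neutral_right) auto
        also have "\<dots> \<le> ennreal (diameter (C k))"
          using C(2)[of k] by (auto intro!: ennreal_leI diameter_subset)
        finally show ?thesis .
      next
        case False
        then have "(\<Sum>i<m. ennreal (diameter (C k \<inter> P i))) = 0" by (intro sum.neutral) auto
        then show ?thesis by simp
      qed
    qed auto
    finally show "(\<Sum>i<m. emeasure lborel ((\<bullet>) (e i) ` P i)) \<le> (\<Sum>k. ennreal (diameter (C k)))" .
  qed
  also have "\<dots> \<le> hausdorff1 A"
    unfolding hausdorff1_def using \<open>0 < d\<close> by (intro SUP_upper) auto
  finally show ?thesis .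
qed

text \<open>For \<open>2 * t < d\<close> the tubes of different pieces are disjoint, so the slice
  bounds add up.\<close>

lemma emeasure_tube_ge_separated:
  fixes A :: "(real^2) set" and m :: nat
  assumes fr: "\<And>i. i < m \<Longrightarrow> frame (e i) (n i)" and P: "\<And>i. i < m \<Longrightarrow> compact (P i)"
    and "compact A" and sub: "\<And>i. i < m \<Longrightarrow> P i \<subseteq> A" and "0 \<le> t" "2 * t < d"
    and sep: "\<And>i j p q. i < m \<Longrightarrow> j < m \<Longrightarrow> i \<noteq> j \<Longrightarrow> p \<in> P i \<Longrightarrow> q \<in> P j \<Longrightarrow> d \<le> dist p q"
  shows "(\<Sum>i<m. emeasure lborel ((\<bullet>) (e i) ` P i)) * ennreal (2 * t) \<le> emeasure lborel (tube A t)"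
proof -
  have "(\<Sum>i<m. emeasure lborel ((\<bullet>) (e i) ` P i)) * ennreal (2 * t) \<le> (\<Sum>i<m. emeasure lborel (tube (P i) t))"
    unfolding sum_distrib_right
    using emeasure_tube_ge[OF fr P \<open>0 \<le> t\<close>] by (intro sum_mono) auto
  also have "\<dots> = emeasure lborel (\<Union>i<m. tube (P i) t)"
  proof (rule sum_emeasure)
    show "disjoint_family_on (\<lambda>i. tube (P i) t) {..<m}"
      unfolding disjoint_family_on_def
    proof (intro ballI impI)
      fix i j assume ij: "i \<in> {..<m}" "j \<in> {..<m}" "i \<noteq> j"
      show "tube (P i) t \<inter> tube (P j) t = {}"
      proof (rule ccontr)
        assume "tube (P i) t \<inter> tube (P j) t \<noteq> {}"
        then obtain x p q where x: "p \<in> P i" "dist x p \<le> t" "q \<in> P j" "dist x q \<le> t"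
          unfolding tube_def by blast
        then have "d \<le> dist p q" using sep[of i j p q] ij by auto
        also have "\<dots> \<le> dist x p + dist x q" by (rule dist_triangle3)
        finally show False using x \<open>2 * t < d\<close> by linarith
      qed
    qed
    show "(\<lambda>i. tube (P i) t) ` {..<m} \<subseteq> sets lborel"
      using P by (auto simp: borel_compact compact_tube)
  qed simp
  also have "\<dots> \<le> emeasure lborel (tube A t)"
    using sub tube_mono[OF _ order_refl] compact_tube[OF \<open>compact A\<close>]
    by (intro emeasure_mono) (blast, simp add: borel_compact)
  finally show ?thesis .
qed

subsection \<open>Local structure of the curve\<close>

text \<open>In the chart the curve is parametrised by \<gamma>, the graph map \<Gamma> followed by
  \<psi>, with continuous nonzero velocity. Near the parameter of \<open>x\<close> the velocity
  stays close to a fixed vector \<open>a\<close>, so all chords are nearly parallel to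
  \<open>a\<close>. The neighbourhood \<open>W\<close> cuts out an open parameter interval, whose
  closure adds only two endpoints; this is why overlaps of pieces will be finite.\<close>

lemma C1_embedded_curve_local:
  assumes curve: "C1_embedded_curve A" and "x \<in> A" "0 < \<epsilon>"
  obtains W e n where "open W" "x \<in> W" "frame e n" "cone_set \<epsilon> e n (closure (A \<inter> W))"
    "finite (closure (A \<inter> W) - W)"
proof -
  obtain U V \<phi> \<psi> and g :: "real \<Rightarrow> real" where
    xU: "x \<in> U" and diffeo: "C1_diffeomorphism U V \<phi> \<psi>" and g: "g C1_differentiable_on UNIV"
    and graph: "\<phi> ` (A \<inter> U) = V \<inter> {v :: real^2. v $ 2 = g (v $ 1)}"
    using bspec[OF curve[unfolded C1_embedded_curve_def] \<open>x \<in> A\<close>] by (elim exE conjE) (rule that)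
  have UV: "open U" "open V" "homeomorphism U V \<phi> \<psi>" and C1: "C1_map_on \<phi> U" "C1_map_on \<psi> V"
    using diffeo by (auto simp: C1_diffeomorphism_def)
  obtain \<phi>' where \<phi>': "\<And>y. y \<in> U \<Longrightarrow> (\<phi> has_derivative blinfun_apply (\<phi>' y)) (at y)"
    using C1(1) unfolding C1_map_on_def by blast
  obtain \<psi>' where \<psi>': "\<And>v. v \<in> V \<Longrightarrow> (\<psi> has_derivative blinfun_apply (\<psi>' v)) (at v)"
    and \<psi>'cont: "continuous_on V \<psi>'"
    using C1(2) unfolding C1_map_on_def by blast
  obtain g' where g': "\<And>s. (g has_vector_derivative g' s) (at s)" and g'cont: "continuous_on UNIV g'"
    using g unfolding C1_differentiable_on_def by blast
  define \<Gamma> :: "real \<Rightarrow> real^2" where "\<Gamma> s = s *\<^sub>R axis 1 1 + g s *\<^sub>R axis 2 1" for s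
  define T :: "real \<Rightarrow> real^2" where "T s = axis 1 1 + g' s *\<^sub>R axis 2 1" for s
  have \<Gamma>_nth: "\<Gamma> s $ 1 = s" "\<Gamma> s $ 2 = g s" for s by (simp_all add: \<Gamma>_def axis_def)
  have \<Gamma>_graph: "v = \<Gamma> (v $ 1)" if "v $ 2 = g (v $ 1)" for v
    using that by (simp add: vec_eq_iff forall_2 \<Gamma>_nth)
  have \<Gamma>': "(\<Gamma> has_vector_derivative T s) (at s)" for s
    unfolding \<Gamma>_def T_def by (auto intro!: derivative_eq_intros g'[folded has_real_derivative_iff_has_vector_derivative])
  have \<Gamma>cont: "continuous_on UNIV \<Gamma>"
    using \<Gamma>' by (auto intro!: continuous_at_imp_continuous_on has_vector_derivative_continuous)
  have Tcont: "continuous_on UNIV T"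
    unfolding T_def by (intro continuous_intros g'cont)
  define N where "N = \<Gamma> -` V"
  have "open N" unfolding N_def by (rule open_vimage[OF UV(2) \<Gamma>cont])
  define \<gamma> where "\<gamma> s = \<psi> (\<Gamma> s)" for s
  define \<gamma>' where "\<gamma>' s = blinfun_apply (\<psi>' (\<Gamma> s)) (T s)" for s
  have \<gamma>': "(\<gamma> has_vector_derivative \<gamma>' s) (at s)" if "s \<in> N" for s
  proof -
    have "(\<psi> has_derivative blinfun_apply (\<psi>' (\<Gamma> s))) (at (\<Gamma> s))"
      using that by (intro \<psi>') (simp add: N_def)
    from has_derivative_compose[OF \<Gamma>'[of s, unfolded has_vector_derivative_def] this]
    show ?thesis by (simp add: has_vector_derivative_def \<gamma>_def[abs_def] \<gamma>'_def blinfun.scaleR_right)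
  qed
  have \<gamma>'cont: "continuous_on N \<gamma>'"
    unfolding \<gamma>'_def N_def
    by (intro continuous_intros continuous_on_compose2[OF \<psi>'cont] continuous_on_subset[OF \<Gamma>cont]
        continuous_on_subset[OF Tcont]) auto
  define s0 where "s0 = \<phi> x $ 1"
  have "\<phi> x \<in> V" "\<phi> x $ 2 = g (\<phi> x $ 1)" using graph \<open>x \<in> A\<close> xU by blast+
  then have s0: "s0 \<in> N" "\<Gamma> s0 = \<phi> x"
    using \<Gamma>_graph[of "\<phi> x"] by (simp_all add: N_def s0_def)
  define a where "a = \<gamma>' s0"
  \<comment> \<open>If the velocity vanished, so would the derivative of \<phi> after \<gamma>; but
    this composition is \<Gamma>, whose first coordinate has derivative 1.\<close>
  have "a \<noteq> 0"
  proof
    assume "a = 0"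
    have "\<psi> (\<Gamma> s0) = x" using UV(3) xU by (simp add: s0 homeomorphism_def)
    then have "(\<phi> has_derivative blinfun_apply (\<phi>' x)) (at (\<gamma> s0))"
      using \<phi>'[OF xU] by (simp add: \<gamma>_def)
    from has_derivative_compose[OF \<gamma>'[OF s0(1), unfolded has_vector_derivative_def] this]
    have d1: "((\<lambda>s. \<phi> (\<gamma> s)) has_derivative (\<lambda>h. 0)) (at s0)"
      using \<open>a = 0\<close> by (simp add: a_def)
    have "((\<lambda>s. \<phi> (\<gamma> s)) has_derivative (\<lambda>h. h *\<^sub>R T s0)) (at s0)"
    proof (rule has_derivative_transform_within_open[OF _ \<open>open N\<close> s0(1)])
      show "(\<Gamma> has_derivative (\<lambda>h. h *\<^sub>R T s0)) (at s0)"
        using \<Gamma>' by (simp add: has_vector_derivative_def)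
      show "\<Gamma> s = \<phi> (\<gamma> s)" if "s \<in> N" for s
        using that UV(3) by (simp add: N_def \<gamma>_def homeomorphism_def)
    qed
    then have "(\<lambda>h::real. h *\<^sub>R T s0) = (\<lambda>h. 0)" by (rule has_derivative_unique[OF _ d1])
    then have "1 *\<^sub>R T s0 = 0" by meson
    then have "T s0 $ 1 = 0" by simp
    then show False by (simp add: T_def axis_def)
  qed
  define e where "e = a /\<^sub>R norm a"
  have "norm e = 1" using \<open>a \<noteq> 0\<close> by (simp add: e_def)
  then obtain n where fr: "frame e n" by (rule frame_exists)
  have ea: "e \<bullet> a = norm a" "n \<bullet> a = 0"
    using fr \<open>a \<noteq> 0\<close> by (simp_all add: frame_def e_def inner_commute dot_square_norm power2_eq_square)
  \<comment> \<open>The solution of c = \<epsilon> (|a| - c): a chord has \<open>n\<close>-component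
    at most c |s - t| and \<open>e\<close>-component at least (|a| - c) |s - t|.\<close>
  define c where "c = \<epsilon> / (1 + \<epsilon>) * norm a"
  have "0 < c" using \<open>a \<noteq> 0\<close> \<open>0 < \<epsilon>\<close> by (simp add: c_def)
  have "isCont \<gamma>' s0" using \<gamma>'cont \<open>open N\<close> s0(1) by (simp add: continuous_on_eq_continuous_at)
  then obtain r1 where r1: "0 < r1" "\<And>s. dist s s0 < r1 \<Longrightarrow> dist (\<gamma>' s) a < c"
    using \<open>0 < c\<close> unfolding continuous_at_eps_delta a_def by blast
  obtain r0 where r0: "0 < r0" "cball s0 r0 \<subseteq> N"
    using \<open>open N\<close> s0(1) by (meson open_contains_cball)
  define \<rho> where "\<rho> = min r0 (r1 / 2)"
  have \<rho>: "0 < \<rho>" "cball s0 \<rho> \<subseteq> N" "\<And>s. s \<in> cball s0 \<rho> \<Longrightarrow> dist (\<gamma>' s) a < c"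
  proof -
    show "0 < \<rho>" using r0(1) r1(1) by (simp add: \<rho>_def)
    show "cball s0 \<rho> \<subseteq> N" using r0(2) by (auto simp: \<rho>_def)
    fix s assume "s \<in> cball s0 \<rho>"
    then have "dist s s0 < r1" using r1(1) by (auto simp: \<rho>_def dist_commute)
    then show "dist (\<gamma>' s) a < c" by (rule r1(2))
  qed
  \<comment> \<open>Mean value inequality for \<gamma>(s) - s a, whose derivative is bounded by
    \<open>c\<close> on the interval.\<close>
  have mvt: "norm ((\<gamma> s - \<gamma> t) - (s - t) *\<^sub>R a) \<le> c * \<bar>s - t\<bar>" if "s \<in> cball s0 \<rho>" "t \<in> cball s0 \<rho>" for s t
  proof -
    have "norm ((\<gamma> s - s *\<^sub>R a) - (\<gamma> t - t *\<^sub>R a)) \<le> c * norm (s - t)"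
    proof (rule differentiable_bound[OF convex_cball _ _ that])
      fix u assume u: "u \<in> cball s0 \<rho>"
      then have "((\<lambda>s. \<gamma> s - s *\<^sub>R a) has_vector_derivative (\<gamma>' u - a)) (at u)"
        using \<rho>(2) by (auto intro!: derivative_eq_intros \<gamma>')
      then show "((\<lambda>s. \<gamma> s - s *\<^sub>R a) has_derivative (\<lambda>h. h *\<^sub>R (\<gamma>' u - a))) (at u within cball s0 \<rho>)"
        unfolding has_vector_derivative_def by (rule has_derivative_at_withinI)
      show "onorm (\<lambda>h. h *\<^sub>R (\<gamma>' u - a)) \<le> c"
      proof (rule onorm_le)
        fix h :: real
        show "norm (h *\<^sub>R (\<gamma>' u - a)) \<le> c * norm h"
          using \<rho>(3)[OF u] mult_left_mono[of "norm (\<gamma>' u - a)" c "\<bar>h\<bar>"] by (simp add: dist_norm mult.commute)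
      qed
    qed
    then show ?thesis by (simp add: algebra_simps)
  qed
  define Q where "Q = \<gamma> ` cball s0 \<rho>"
  have coneQ: "cone_set \<epsilon> e n Q"
    unfolding cone_set_def Q_def
  proof (intro ballI, elim imageE, hypsubst)
    fix s t assume st: "s \<in> cball s0 \<rho>" "t \<in> cball s0 \<rho>"
    define z where "z = (\<gamma> s - \<gamma> t) - (s - t) *\<^sub>R a"
    have z: "norm z \<le> c * \<bar>s - t\<bar>" using mvt[OF st] by (simp add: z_def)
    have "n \<bullet> z = n \<bullet> (\<gamma> s - \<gamma> t)" "e \<bullet> z = e \<bullet> (\<gamma> s - \<gamma> t) - (s - t) * norm a"
      by (simp_all add: z_def inner_diff_right ea)
    moreover have "\<bar>n \<bullet> z\<bar> \<le> norm z" "\<bar>e \<bullet> z\<bar> \<le> norm z" using frame_inner_le[OF fr] by auto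
    ultimately have nz: "\<bar>n \<bullet> (\<gamma> s - \<gamma> t)\<bar> \<le> c * \<bar>s - t\<bar>"
      and ez: "\<bar>(s - t) * norm a\<bar> - c * \<bar>s - t\<bar> \<le> \<bar>e \<bullet> (\<gamma> s - \<gamma> t)\<bar>" using z by linarith+
    have "\<bar>(s - t) * norm a\<bar> = \<bar>s - t\<bar> * norm a" by (simp only: abs_mult abs_norm_cancel)
    then have "c * \<bar>s - t\<bar> = \<epsilon> * (\<bar>(s - t) * norm a\<bar> - c * \<bar>s - t\<bar>)"
      using \<open>0 < \<epsilon>\<close> by (simp only: c_def) (simp add: field_simps)
    also have "\<dots> \<le> \<epsilon> * \<bar>e \<bullet> (\<gamma> s - \<gamma> t)\<bar>"
      using ez \<open>0 < \<epsilon>\<close> by (intro mult_left_mono) auto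
    finally show "\<bar>n \<bullet> (\<gamma> s - \<gamma> t)\<bar> \<le> \<epsilon> * \<bar>e \<bullet> (\<gamma> s - \<gamma> t)\<bar>" using nz by linarith
  qed
  \<comment> \<open>An open interval here against the closed one in \<open>Q\<close>: then
    \<open>W\<close> is open, and the compact arc \<open>Q\<close> contains the closure of
    \<open>A \<inter> W\<close>.\<close>
  define W where "W = U \<inter> \<phi> -` {v. v $ 1 \<in> ball s0 \<rho>}"
  have "open {v :: real^2. v $ 1 \<in> ball s0 \<rho>}"
    using open_vimage[OF open_ball, of "\<lambda>v :: real^2. v $ 1" s0 \<rho>]
    by (simp add: vimage_def continuous_on_component)
  then have "open W"
    unfolding W_def using UV(1,3) by (intro continuous_open_preimage) (auto simp: homeomorphism_def)
  moreover have "x \<in> W" using xU \<rho>(1) by (simp add: W_def s0_def)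
  moreover have clQ: "closure (A \<inter> W) \<subseteq> Q"
  proof (rule closure_minimal)
    show "A \<inter> W \<subseteq> Q"
    proof
      fix y assume y: "y \<in> A \<inter> W"
      then have "\<phi> y \<in> V \<inter> {v. v $ 2 = g (v $ 1)}" using graph by (auto simp: W_def)
      then have "\<phi> y = \<Gamma> (\<phi> y $ 1)" by (intro \<Gamma>_graph) simp
      moreover have "\<psi> (\<phi> y) = y" using y UV(3) by (simp add: W_def homeomorphism_def)
      ultimately have "y = \<gamma> (\<phi> y $ 1)" by (simp add: \<gamma>_def)
      moreover have "\<phi> y $ 1 \<in> cball s0 \<rho>" using y by (simp add: W_def)
      ultimately show "y \<in> Q" unfolding Q_def by (rule image_eqI)
    qed
    have "continuous_on (cball s0 \<rho>) \<gamma>"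
      using \<gamma>' \<rho>(2) by (intro continuous_at_imp_continuous_on ballI has_vector_derivative_continuous) blast
    then show "closed Q" unfolding Q_def by (intro compact_imp_closed compact_continuous_image) auto
  qed
  moreover have "finite (closure (A \<inter> W) - W)"
  proof (rule finite_subset)
    show "closure (A \<inter> W) - W \<subseteq> \<gamma> ` {s0 - \<rho>, s0 + \<rho>}"
    proof
      fix y assume y: "y \<in> closure (A \<inter> W) - W"
      then obtain s where s: "s \<in> cball s0 \<rho>" "y = \<gamma> s" using clQ by (auto simp: Q_def)
      have "\<Gamma> s \<in> V" using s(1) \<rho>(2) by (auto simp: N_def)
      then have "\<phi> y = \<Gamma> s" "y \<in> U" using UV(3) by (auto simp: s(2) \<gamma>_def homeomorphism_def)
      then have "s \<notin> ball s0 \<rho>" using y by (auto simp: W_def \<Gamma>_nth)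
      then have "s = s0 - \<rho> \<or> s = s0 + \<rho>" using s(1) by (auto simp: dist_real_def)
      then show "y \<in> \<gamma> ` {s0 - \<rho>, s0 + \<rho>}" using s(2) by blast
    qed
  qed simp
  ultimately show ?thesis by (intro that[OF _ _ fr cone_set_subset[OF coneQ]])
qed

text \<open>From the closure of each chart piece the earlier open charts are removed, which
  preserves compactness. A point common to \<open>P i\<close> and an earlier \<open>P j\<close> lies
  in the closure of \<open>A \<inter> W j\<close> but not in \<open>W j\<close>, hence in a finite
  set. \<open>F\<close> collects these sets.\<close>

lemma closed_C1_curve_pieces:
  assumes "compact A" "C1_embedded_curve A" "0 < \<epsilon>"
  obtains m :: nat and e n P F where
    "\<And>i. i < m \<Longrightarrow> frame (e i) (n i)" "\<And>i. i < m \<Longrightarrow> compact (P i)"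
    "\<And>i. i < m \<Longrightarrow> cone_set \<epsilon> (e i) (n i) (P i)" "(\<Union>i<m. P i) = A"
    "finite F" "\<And>i j. i < m \<Longrightarrow> j < m \<Longrightarrow> i \<noteq> j \<Longrightarrow> P i \<inter> P j \<subseteq> F"
proof -
  have "\<exists>W e n. open W \<and> x \<in> W \<and> frame e n \<and> cone_set \<epsilon> e n (closure (A \<inter> W)) \<and> finite (closure (A \<inter> W) - W)"
    if "x \<in> A" for x
    by (rule C1_embedded_curve_local[OF assms(2) that assms(3)]) blast
  then obtain W0 e0 n0 where W0: "\<And>x. x \<in> A \<Longrightarrow> open (W0 x) \<and> x \<in> W0 x \<and> frame (e0 x) (n0 x)
      \<and> cone_set \<epsilon> (e0 x) (n0 x) (closure (A \<inter> W0 x)) \<and> finite (closure (A \<inter> W0 x) - W0 x)"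
    by metis
  obtain C where C: "C \<subseteq> A" "finite C" "A \<subseteq> (\<Union>x\<in>C. W0 x)"
    using compactE_image[OF assms(1), of A W0] W0 by blast
  obtain b where b: "bij_betw b {..<card C} C"
    using ex_bij_betw_nat_finite[OF C(2)] by (auto simp: lessThan_atLeast0)
  define m where "m = card C"
  define W where "W i = W0 (b i)" for i
  define P where "P i = closure (A \<inter> W i) - (\<Union>j<i. W j)" for i
  define F where "F = (\<Union>i<m. closure (A \<inter> W i) - W i)"
  have bA: "b i \<in> A" if "i < m" for i
    using that b C(1) unfolding bij_betw_def m_def by blast
  have clA: "closure (A \<inter> W i) \<subseteq> A" for i
    using assms(1) by (intro closure_minimal) (auto simp: compact_imp_closed)
  have comp: "compact (P i)" if "i < m" for i
  proof -
    have "open (\<Union>j<i. W j)" using W0 bA that by (auto simp: W_def)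
    moreover have "compact (closure (A \<inter> W i))"
      unfolding compact_closure by (rule bounded_subset[OF compact_imp_bounded[OF assms(1)]]) simp
    ultimately show ?thesis unfolding P_def by (rule compact_diff[rotated])
  qed
  have cover: "A \<subseteq> (\<Union>i<m. P i)"
  proof
    fix x assume "x \<in> A"
    then obtain c where "c \<in> C" "x \<in> W0 c" using C(3) by blast
    moreover have "b ` {..<m} = C" using b by (simp add: bij_betw_def m_def)
    ultimately obtain i0 where "i0 < m" "x \<in> W i0" unfolding W_def by blast
    \<comment> \<open>The first chart containing \<open>x\<close> is not affected by the removal of
      earlier charts.\<close>
    define i where "i = (LEAST i. x \<in> W i)"
    have "x \<in> W i" unfolding i_def using \<open>x \<in> W i0\<close> by (rule LeastI)
    moreover have "i < m" using Least_le[of "\<lambda>i. x \<in> W i", OF \<open>x \<in> W i0\<close>] \<open>i0 < m\<close> by (simp add: i_def)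
    moreover have "x \<notin> W j" if "j < i" for j using that not_less_Least unfolding i_def by blast
    ultimately show "x \<in> (\<Union>i<m. P i)"
      using \<open>x \<in> A\<close> closure_subset[of "A \<inter> W i"] by (auto simp: P_def)
  qed
  have inter: "P i \<inter> P j \<subseteq> F" if "i < m" "j < i" for i j
    using that unfolding P_def F_def by fastforce
  show ?thesis
  proof (rule that[of m "\<lambda>i. e0 (b i)" "\<lambda>i. n0 (b i)" P F])
    show "cone_set \<epsilon> (e0 (b i)) (n0 (b i)) (P i)" if "i < m" for i
      using W0[OF bA[OF that]] by (auto simp: P_def W_def intro: cone_set_subset)
    show "(\<Union>i<m. P i) = A" using cover clA by (auto simp: P_def)
    show "finite F" using W0 bA by (auto simp: F_def W_def)
    show "P i \<inter> P j \<subseteq> F" if "i < m" "j < m" "i \<noteq> j" for i j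
      using inter[of i j] inter[of j i] that by (metis inf_commute linorder_neqE_nat)
  qed (use W0 bA comp in auto)
qed

subsection \<open>Minkowski content of the curve\<close>

lemma separated_compact_family:
  fixes P :: "nat \<Rightarrow> 'a::heine_borel set"
  assumes P: "\<And>i. i < m \<Longrightarrow> compact (P i)"
    and disj: "\<And>i j. i < m \<Longrightarrow> j < m \<Longrightarrow> i \<noteq> j \<Longrightarrow> P i \<inter> P j = {}"
  obtains d where "0 < d"
    "\<And>i j p q. i < m \<Longrightarrow> j < m \<Longrightarrow> i \<noteq> j \<Longrightarrow> p \<in> P i \<Longrightarrow> q \<in> P j \<Longrightarrow> d \<le> dist p q"
proof -
  have "\<exists>d>0. i < m \<longrightarrow> j < m \<longrightarrow> i \<noteq> j \<longrightarrow> (\<forall>p\<in>P i. \<forall>q\<in>P j. d \<le> dist p q)" for i j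
  proof (cases "i < m \<and> j < m \<and> i \<noteq> j")
    case True
    then show ?thesis
      using separate_compact_closed[OF P compact_imp_closed[OF P] disj, of i j] by simp
  qed (auto intro: exI[of _ 1])
  then obtain \<delta> where \<delta>: "\<And>i j. \<delta> i j > 0"
    "\<And>i j. i < m \<Longrightarrow> j < m \<Longrightarrow> i \<noteq> j \<Longrightarrow> \<forall>p\<in>P i. \<forall>q\<in>P j. \<delta> i j \<le> dist p q"
    by metis
  \<comment> \<open>The inserted 1 keeps the minimum over a nonempty set when there are no
    pieces.\<close>
  define d where "d = Min (insert 1 ((\<lambda>(i, j). \<delta> i j) ` ({..<m} \<times> {..<m})))"
  show ?thesis
  proof (rule that[of d])
    show "0 < d" unfolding d_def using \<delta>(1) by (subst Min_gr_iff) auto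
    fix i j p q assume ij: "i < m" "j < m" "i \<noteq> j" "p \<in> P i" "q \<in> P j"
    then have "d \<le> \<delta> i j" unfolding d_def by (intro Min_le) auto
    then show "d \<le> dist p q" using \<delta>(2)[OF ij(1-3)] ij(4,5) by (meson order_trans)
  qed
qed

text \<open>Each removed ball projects into an interval of length \<open>2 * \<rho>\<close>, so
  removing all of them loses at most that length per centre.\<close>

lemma emeasure_proj_minus_balls:
  fixes P :: "'a::euclidean_space set"
  assumes "norm e = 1" "compact P" "finite F" "0 < \<rho>"
  shows "emeasure lborel ((\<bullet>) e ` P)
    \<le> emeasure lborel ((\<bullet>) e ` (P - (\<Union>p\<in>F. ball p \<rho>))) + ennreal (real (card F) * (2 * \<rho>))"
proof -
  let ?P' = "P - (\<Union>p\<in>F. ball p \<rho>)"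
  have "compact ((\<bullet>) e ` ?P')"
    by (intro compact_continuous_image continuous_intros compact_diff assms open_UN ballI open_ball)
  then have P': "(\<bullet>) e ` ?P' \<in> sets lborel" by (simp add: borel_compact)
  have "(\<bullet>) e ` P \<subseteq> (\<bullet>) e ` ?P' \<union> (\<Union>p\<in>F. {e \<bullet> p - \<rho>..e \<bullet> p + \<rho>})"
  proof
    fix u assume "u \<in> (\<bullet>) e ` P"
    then obtain x where x: "x \<in> P" "u = e \<bullet> x" by auto
    show "u \<in> (\<bullet>) e ` ?P' \<union> (\<Union>p\<in>F. {e \<bullet> p - \<rho>..e \<bullet> p + \<rho>})"
    proof (cases "x \<in> (\<Union>p\<in>F. ball p \<rho>)")
      case True
      then obtain p where p: "p \<in> F" "dist p x < \<rho>" by auto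
      have "\<bar>e \<bullet> (p - x)\<bar> \<le> dist p x"
        using Cauchy_Schwarz_ineq2[of e "p - x"] assms(1) by (simp add: dist_norm)
      then have "u \<in> {e \<bullet> p - \<rho>..e \<bullet> p + \<rho>}" using p(2) by (auto simp: x(2) inner_diff_right)
      with p(1) show ?thesis by blast
    qed (use x in blast)
  qed
  moreover have B: "(\<Union>p\<in>F. {e \<bullet> p - \<rho>..e \<bullet> p + \<rho>}) \<in> sets lborel"
    using assms(3) by (intro sets.finite_UN) auto
  ultimately have "emeasure lborel ((\<bullet>) e ` P) \<le> emeasure lborel ((\<bullet>) e ` ?P' \<union> (\<Union>p\<in>F. {e \<bullet> p - \<rho>..e \<bullet> p + \<rho>}))"
    using P' by (intro emeasure_mono sets.Un)
  also have "\<dots> \<le> emeasure lborel ((\<bullet>) e ` ?P') + emeasure lborel (\<Union>p\<in>F. {e \<bullet> p - \<rho>..e \<bullet> p + \<rho>})"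
    using P' B by (intro emeasure_subadditive)
  also have "emeasure lborel (\<Union>p\<in>F. {e \<bullet> p - \<rho>..e \<bullet> p + \<rho>}) \<le> (\<Sum>p\<in>F. emeasure lborel {e \<bullet> p - \<rho>..e \<bullet> p + \<rho>})"
    using assms(3) by (intro emeasure_subadditive_finite) auto
  also have "\<dots> = (\<Sum>p\<in>F. ennreal (2 * \<rho>))"
    using assms(4) by (intro sum.cong) auto
  also have "\<dots> = ennreal (real (card F) * (2 * \<rho>))"
    using assms(4) by (simp add: ennreal_mult ennreal_of_nat_eq_real_of_nat)
  finally show ?thesis by (simp add: add_left_mono)
qed

text \<open>Length and tube area are both compared with the total projection \<open>S\<close> of the
  pieces. Whole pieces give L \<le> (1 + \<epsilon>) S and bound the area by about 2 (1 +
  \<epsilon>) S t; trimmed, separated pieces with total projection \<open>S'\<close> give S' \<le> L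
  and area at least 2 S' t. The trimming costs at most \<zeta>, so S and S' are both close to
  L.\<close>

lemma minkowski_content:
  assumes A: "compact A" "C1_embedded_curve A" and L: "hausdorff1 A = ennreal L" "0 \<le> L" and "0 < \<eta>"
  obtains \<tau> where "0 < \<tau>"
    "\<And>t. 0 \<le> t \<Longrightarrow> t \<le> \<tau> \<Longrightarrow> ennreal ((2 * L - \<eta>) * t) \<le> emeasure lborel (tube A t)"
    "\<And>t. 0 \<le> t \<Longrightarrow> t \<le> \<tau> \<Longrightarrow> emeasure lborel (tube A t) \<le> ennreal ((2 * L + \<eta>) * t)"
proof -
  \<comment> \<open>Gives \<epsilon> L \<le> \<eta>/4; \<open>L + 1\<close> instead of
    \<open>L\<close> allows length 0.\<close>
  define \<epsilon> where "\<epsilon> = min 1 (\<eta> / (4 * (L + 1)))"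
  have \<epsilon>: "0 < \<epsilon>" "\<epsilon> \<le> 1" using \<open>0 < \<eta>\<close> \<open>0 \<le> L\<close> by (auto simp: \<epsilon>_def)
  have \<epsilon>L: "\<epsilon> * L \<le> \<eta> / 4"
  proof -
    have "\<epsilon> * L \<le> \<eta> / (4 * (L + 1)) * (L + 1)"
      using \<open>0 < \<eta>\<close> \<open>0 \<le> L\<close> by (intro mult_mono) (auto simp: \<epsilon>_def)
    also have "\<dots> = \<eta> / 4" using \<open>0 \<le> L\<close> by (simp add: field_simps)
    finally show ?thesis .
  qed
  \<comment> \<open>The final estimate 2 (1 + \<epsilon>) (L + 2 \<zeta>) exceeds 2 L by at most 2
    \<epsilon> L + 8 \<zeta> \<le> \<eta>/2 + \<eta>/2.\<close>
  define \<zeta> where "\<zeta> = \<eta> / 16"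
  have "0 < \<zeta>" using \<open>0 < \<eta>\<close> by (simp add: \<zeta>_def)
  obtain m :: nat and e n P F where
    fr: "\<And>i. i < m \<Longrightarrow> frame (e i) (n i)" and comp: "\<And>i. i < m \<Longrightarrow> compact (P i)" and
    cone: "\<And>i. i < m \<Longrightarrow> cone_set \<epsilon> (e i) (n i) (P i)" and cover: "(\<Union>i<m. P i) = A" and
    F: "finite F" "\<And>i j. i < m \<Longrightarrow> j < m \<Longrightarrow> i \<noteq> j \<Longrightarrow> P i \<inter> P j \<subseteq> F"
    by (rule closed_C1_curve_pieces[OF A \<epsilon>(1)]) metis
  define s where "s i = measure lborel ((\<bullet>) (e i) ` P i)" for i
  define S where "S = (\<Sum>i<m. s i)"
  have "0 \<le> s i" for i by (simp add: s_def)
  then have "0 \<le> S" by (simp add: S_def sum_nonneg)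
  have proj: "emeasure lborel ((\<bullet>) (e i) ` Q) = ennreal (measure lborel ((\<bullet>) (e i) ` Q))" if "compact Q" for i Q
  proof -
    have "compact ((\<bullet>) (e i) ` Q)" by (intro compact_continuous_image continuous_intros that)
    then have "emeasure lborel ((\<bullet>) (e i) ` Q) < \<infinity>"
      by (intro emeasure_bounded_finite compact_imp_bounded)
    then show ?thesis by (intro emeasure_eq_ennreal_measure) auto
  qed
  have "ennreal L \<le> ennreal (1 + \<epsilon>) * (\<Sum>i<m. emeasure lborel ((\<bullet>) (e i) ` P i))"
    using hausdorff1_Union_cone_le[where e=e and n=n and P=P and m=m, OF fr comp cone] \<epsilon>(1)
    unfolding cover L(1) by simp
  also have "\<dots> = ennreal (1 + \<epsilon>) * ennreal S"
    using proj comp by (simp add: S_def s_def sum_ennreal)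
  also have "\<dots> = ennreal ((1 + \<epsilon>) * S)" using \<epsilon>(1) \<open>0 \<le> S\<close> by (intro ennreal_mult[symmetric]) auto
  finally have L_le: "L \<le> (1 + \<epsilon>) * S" using \<epsilon>(1) \<open>0 \<le> S\<close> by (subst (asm) ennreal_le_iff) auto
  have S_ge: "L - \<eta> / 4 \<le> S"
  proof -
    have "(1 - \<epsilon>) * L \<le> (1 - \<epsilon>) * ((1 + \<epsilon>) * S)" using L_le \<epsilon>(2) by (intro mult_left_mono) auto
    also have "\<dots> = (1 - \<epsilon>\<^sup>2) * S" by (simp add: algebra_simps power2_eq_square)
    also have "\<dots> \<le> 1 * S" using \<open>0 \<le> S\<close> by (intro mult_right_mono) auto
    finally show ?thesis using \<epsilon>L by (simp add: algebra_simps)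
  qed
  \<comment> \<open>Trimming all \<open>m\<close> pieces loses at most 2 m |F| \<rho>, which is to
    stay below \<zeta>; the added 1 keeps the denominator positive.\<close>
  define \<rho> where "\<rho> = \<zeta> / (2 * real m * real (card F) + 1)"
  have D: "0 < 2 * real m * real (card F) + 1" by (intro add_nonneg_pos) auto
  then have "0 < \<rho>" unfolding \<rho>_def using \<open>0 < \<zeta>\<close> by (intro divide_pos_pos)
  have \<rho>_le: "real m * (real (card F) * (2 * \<rho>)) \<le> \<zeta>"
  proof -
    have "(2 * real m * real (card F) + 1) * \<rho> = \<zeta>"
      unfolding \<rho>_def times_divide_eq_right using D by (intro nonzero_mult_div_cancel_left) linarith
    then show ?thesis using \<open>0 < \<rho>\<close> by (simp add: algebra_simps)
  qed
  \<comment> \<open>Removing open balls around the overlap points leaves compact and now disjoint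
    pieces, hence pieces at positive distance.\<close>
  define P' where "P' i = P i - (\<Union>p\<in>F. ball p \<rho>)" for i
  have comp': "compact (P' i)" if "i < m" for i
    unfolding P'_def by (intro compact_diff comp that open_UN ballI open_ball)
  have "P' i \<inter> P' j = {}" if "i < m" "j < m" "i \<noteq> j" for i j
    using F(2)[OF that] \<open>0 < \<rho>\<close> by (fastforce simp: P'_def)
  then obtain d where "0 < d" and
    d: "\<And>i j p q. i < m \<Longrightarrow> j < m \<Longrightarrow> i \<noteq> j \<Longrightarrow> p \<in> P' i \<Longrightarrow> q \<in> P' j \<Longrightarrow> d \<le> dist p q"
    using separated_compact_family[of m P'] comp' by metis
  define S' where "S' = (\<Sum>i<m. measure lborel ((\<bullet>) (e i) ` P' i))"
  have "0 \<le> S'" by (simp add: S'_def sum_nonneg)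
  have S': "(\<Sum>i<m. emeasure lborel ((\<bullet>) (e i) ` P' i)) = ennreal S'"
    using proj comp' by (simp add: S'_def sum_ennreal)
  have ne: "norm (e i) = 1" if "i < m" for i using fr[OF that] by (simp add: frame_def)
  have sub': "P' i \<subseteq> A" if "i < m" for i using cover that by (auto simp: P'_def)
  have "S \<le> (\<Sum>i<m. measure lborel ((\<bullet>) (e i) ` P' i) + real (card F) * (2 * \<rho>))"
    unfolding S_def
  proof (rule sum_mono)
    fix i assume "i \<in> {..<m}"
    then have "i < m" by simp
    then have "ennreal (s i) \<le> ennreal (measure lborel ((\<bullet>) (e i) ` P' i)) + ennreal (real (card F) * (2 * \<rho>))"
      using emeasure_proj_minus_balls[OF ne comp F(1) \<open>0 < \<rho>\<close>, of i i] proj[OF comp] proj[OF comp']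
      by (simp add: s_def P'_def)
    then show "s i \<le> measure lborel ((\<bullet>) (e i) ` P' i) + real (card F) * (2 * \<rho>)"
      using \<open>0 < \<rho>\<close> by (simp add: ennreal_plus[symmetric] del: ennreal_plus)
  qed
  also have "\<dots> = S' + real m * (real (card F) * (2 * \<rho>))" by (simp add: S'_def sum.distrib)
  finally have SS': "S \<le> S' + \<zeta>" using \<rho>_le by linarith
  have "ennreal S' \<le> ennreal L"
    unfolding S'[symmetric] L(1)[symmetric] by (rule hausdorff1_ge_separated[where e=e and P=P' and m=m, OF ne sub' \<open>0 < d\<close> d])
  then have "S' \<le> L" using \<open>0 \<le> L\<close> by simp
  define \<theta> where "\<theta> = \<zeta> / (real m + 1)"
  have "0 < \<theta>" using \<open>0 < \<zeta>\<close> by (simp add: \<theta>_def)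
  have m\<theta>: "real m * \<theta> \<le> \<zeta>"
  proof -
    have "(real m + 1) * \<theta> = \<zeta>" unfolding \<theta>_def by (simp add: add_nonneg_pos)
    then show ?thesis using \<open>0 < \<theta>\<close> by (simp add: algebra_simps)
  qed
  have "\<exists>\<tau>>0. i < m \<longrightarrow> (\<forall>t\<le>\<tau>. emeasure lborel (tube ((\<bullet>) (e i) ` P i) t) \<le> ennreal (s i + \<theta>))" for i
  proof (cases "i < m")
    case True
    have K: "compact ((\<bullet>) (e i) ` P i)" by (intro compact_continuous_image continuous_intros comp True)
    obtain \<tau> where "0 < \<tau>" "\<And>t. t \<le> \<tau> \<Longrightarrow> emeasure lborel (tube ((\<bullet>) (e i) ` P i) t) \<le> emeasure lborel ((\<bullet>) (e i) ` P i) + ennreal \<theta>"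
      using emeasure_tube_limit[OF K \<open>0 < \<theta>\<close>] by metis
    moreover have "emeasure lborel ((\<bullet>) (e i) ` P i) + ennreal \<theta> = ennreal (s i + \<theta>)"
      using proj[OF comp[OF True]] \<open>0 < \<theta>\<close> by (simp add: s_def)
    ultimately show ?thesis by (intro exI[of _ \<tau>]) simp
  qed (auto intro: exI[of _ 1])
  then obtain \<tau>i where \<tau>i: "\<And>i. 0 < \<tau>i i"
    "\<And>i t. i < m \<Longrightarrow> t \<le> \<tau>i i \<Longrightarrow> emeasure lborel (tube ((\<bullet>) (e i) ` P i) t) \<le> ennreal (s i + \<theta>)"
    by metis
  \<comment> \<open>\<open>d / 3\<close> ensures \<open>2 * t < d\<close>; the other radii keep the
    tubes of the projections within \<theta> of the projections in measure.\<close>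
  define \<tau> where "\<tau> = Min (insert (d / 3) (\<tau>i ` {..<m}))"
  show ?thesis
  proof (rule that[of \<tau>])
    show "0 < \<tau>" unfolding \<tau>_def using \<tau>i(1) \<open>0 < d\<close> by (subst Min_gr_iff) auto
  next
    fix t assume t: "0 \<le> t" "t \<le> \<tau>"
    have "\<tau> \<le> d / 3" unfolding \<tau>_def by (intro Min_le) auto
    then have "2 * t < d" using t \<open>0 < d\<close> by linarith
    have "(2 * L - \<eta>) * t \<le> S' * (2 * t)"
      using mult_right_mono[of "2 * L - \<eta>" "S' * 2" t] t(1) S_ge SS' \<open>0 < \<eta>\<close> by (simp add: \<zeta>_def mult.assoc)
    then have "ennreal ((2 * L - \<eta>) * t) \<le> ennreal (S' * (2 * t))" by (rule ennreal_leI)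
    also have "\<dots> = (\<Sum>i<m. emeasure lborel ((\<bullet>) (e i) ` P' i)) * ennreal (2 * t)"
      unfolding S' using t(1) \<open>0 \<le> S'\<close> by (intro ennreal_mult) auto
    also have "\<dots> \<le> emeasure lborel (tube A t)"
      by (rule emeasure_tube_ge_separated[where e=e and n=n and P=P' and m=m, OF fr comp' A(1) sub' t(1) \<open>2 * t < d\<close> d])
    finally show "ennreal ((2 * L - \<eta>) * t) \<le> emeasure lborel (tube A t)" .
  next
    fix t assume t: "0 \<le> t" "t \<le> \<tau>"
    have "tube A t = (\<Union>i<m. tube (P i) t)" unfolding cover[symmetric] by (auto simp: tube_def)
    then have "emeasure lborel (tube A t) \<le> (\<Sum>i<m. emeasure lborel (tube (P i) t))"
      using compact_tube[OF comp] by (simp only:) (intro emeasure_subadditive_finite, auto simp: borel_compact)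
    also have "\<dots> \<le> (\<Sum>i<m. ennreal ((s i + \<theta>) * (2 * (1 + \<epsilon>) * t)))"
    proof (rule sum_mono)
      fix i assume "i \<in> {..<m}"
      then have i: "i < m" by simp
      then have "\<tau> \<le> \<tau>i i" unfolding \<tau>_def by (intro Min_le) auto
      then have "t \<le> \<tau>i i" using t(2) by simp
      have "emeasure lborel (tube (P i) t) \<le> emeasure lborel (tube ((\<bullet>) (e i) ` P i) t) * ennreal (2 * (1 + \<epsilon>) * t)"
        using emeasure_tube_le[OF fr[OF i] comp[OF i] cone[OF i] t(1)] \<epsilon>(1) by simp
      also have "\<dots> \<le> ennreal (s i + \<theta>) * ennreal (2 * (1 + \<epsilon>) * t)"
        by (intro mult_right_mono \<tau>i(2)[OF i \<open>t \<le> \<tau>i i\<close>]) simp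
      also have "\<dots> = ennreal ((s i + \<theta>) * (2 * (1 + \<epsilon>) * t))"
        using \<open>0 \<le> s i\<close> \<open>0 < \<theta>\<close> \<epsilon>(1) t(1) by (intro ennreal_mult[symmetric]) auto
      finally show "emeasure lborel (tube (P i) t) \<le> ennreal ((s i + \<theta>) * (2 * (1 + \<epsilon>) * t))" .
    qed
    also have "\<dots> = ennreal (\<Sum>i<m. (s i + \<theta>) * (2 * (1 + \<epsilon>) * t))"
      using \<open>\<And>i. 0 \<le> s i\<close> \<open>0 < \<theta>\<close> \<epsilon>(1) t(1) by (intro sum_ennreal) auto
    also have "(\<Sum>i<m. (s i + \<theta>) * (2 * (1 + \<epsilon>) * t)) = (S + real m * \<theta>) * (2 * (1 + \<epsilon>)) * t"
      by (simp add: sum_distrib_right[symmetric] sum.distrib S_def mult.assoc)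
    also have "\<dots> \<le> (2 * L + \<eta>) * t"
    proof (rule mult_right_mono[OF _ t(1)])
      have "(S + real m * \<theta>) * (2 * (1 + \<epsilon>)) \<le> (L + 2 * \<zeta>) * (2 * (1 + \<epsilon>))"
        using SS' \<open>S' \<le> L\<close> m\<theta> \<epsilon>(1) by (intro mult_right_mono) auto
      also have "\<dots> = 2 * L + 4 * \<zeta> + 2 * (\<epsilon> * L) + \<epsilon> * (4 * \<zeta>)" by (simp add: algebra_simps)
      also have "\<epsilon> * (4 * \<zeta>) \<le> 1 * (4 * \<zeta>)" using \<epsilon>(2) \<open>0 < \<zeta>\<close> by (intro mult_right_mono) auto
      finally show "(S + real m * \<theta>) * (2 * (1 + \<epsilon>)) \<le> 2 * L + \<eta>" using \<epsilon>L by (simp add: \<zeta>_def)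
    qed
    finally show "emeasure lborel (tube A t) \<le> ennreal ((2 * L + \<eta>) * t)" by (simp add: ennreal_leI)
  qed
qed

subsection \<open>Layer cake formula\<close>

lemma powr_eq_nn_integral:
  fixes s y \<epsilon> :: real
  assumes "s < 1" "0 < y" "y \<le> \<epsilon>"
  shows "ennreal (y powr (s - 1)) = ennreal (\<epsilon> powr (s - 1))
    + (\<integral>\<^sup>+t. ennreal ((1 - s) * t powr (s - 2)) * indicator {y..\<epsilon>} t \<partial>lborel)"
proof -
  have "(\<integral>\<^sup>+t. ennreal ((1 - s) * t powr (s - 2)) * indicator {y..\<epsilon>} t \<partial>lborel)
      = ennreal (- (\<epsilon> powr (s - 1)) - - (y powr (s - 1)))"
  proof (rule nn_integral_FTC_Icc[where F = "\<lambda>t. - (t powr (s - 1))"])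
    fix t assume "t \<in> {y..\<epsilon>}"
    then have "0 < t" using assms(2) by simp
    then show "((\<lambda>t. - (t powr (s - 1))) has_real_derivative (1 - s) * t powr (s - 2)) (at t)"
      by (auto intro!: derivative_eq_intros simp: algebra_simps)
  qed (use assms in auto)
  moreover have "\<epsilon> powr (s - 1) \<le> y powr (s - 1)"
    using assms by (intro powr_mono2') auto
  ultimately show ?thesis by (simp add: ennreal_plus[symmetric] del: ennreal_plus)
qed

text \<open>Each value of the power is written as its value at \<epsilon> plus the integral of its
  decrease from \<open>f x\<close> to \<epsilon>, and Tonelli exchanges \<open>x\<close> and
  \<open>t\<close>. Cutting at \<epsilon> produces the boundary term.\<close>

lemma layer_cake:
  fixes f :: "'a::euclidean_space \<Rightarrow> real"
  assumes f [measurable]: "f \<in> borel_measurable borel" and s: "0 < s" "s < 1" and "0 < \<epsilon>"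
  shows "(\<integral>\<^sup>+x\<in>{x. 0 < f x \<and> f x \<le> \<epsilon>}. ennreal (f x powr (s - 1)) \<partial>lborel) =
    ennreal (\<epsilon> powr (s - 1)) * emeasure lborel {x. 0 < f x \<and> f x \<le> \<epsilon>}
    + (\<integral>\<^sup>+t\<in>{0<..\<epsilon>}. ennreal ((1 - s) * t powr (s - 2)) * emeasure lborel {x. 0 < f x \<and> f x \<le> t} \<partial>lborel)"
proof -
  let ?g = "\<lambda>t::real. ennreal ((1 - s) * t powr (s - 2))"
  let ?E = "\<lambda>t. {x. 0 < f x \<and> f x \<le> t}"
  define h :: "'a \<Rightarrow> real \<Rightarrow> ennreal"
    where "h x t = (if 0 < f x \<and> f x \<le> t \<and> t \<le> \<epsilon> then ?g t else 0)" for x t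
  have E [measurable]: "?E t \<in> sets lborel" for t by measurable
  have h [measurable]: "case_prod h \<in> borel_measurable (lborel \<Otimes>\<^sub>M lborel)"
    unfolding h_def case_prod_unfold by measurable
  have "(\<integral>\<^sup>+x\<in>?E \<epsilon>. ennreal (f x powr (s - 1)) \<partial>lborel)
      = (\<integral>\<^sup>+x. ennreal (\<epsilon> powr (s - 1)) * indicator (?E \<epsilon>) x + (\<integral>\<^sup>+t. h x t \<partial>lborel) \<partial>lborel)"
  proof (rule nn_integral_cong)
    fix x
    show "ennreal (f x powr (s - 1)) * indicator (?E \<epsilon>) x
        = ennreal (\<epsilon> powr (s - 1)) * indicator (?E \<epsilon>) x + (\<integral>\<^sup>+t. h x t \<partial>lborel)"
    proof (cases "x \<in> ?E \<epsilon>")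
      case True
      then have "h x = (\<lambda>t. ?g t * indicator {f x..\<epsilon>} t)"
        by (auto simp: h_def fun_eq_iff indicator_def)
      then show ?thesis using powr_eq_nn_integral[OF s(2), of "f x" \<epsilon>] True by simp
    next
      case False
      then have "h x = (\<lambda>t. 0)" by (auto simp: h_def fun_eq_iff)
      then show ?thesis using False by simp
    qed
  qed
  also have "\<dots> = ennreal (\<epsilon> powr (s - 1)) * emeasure lborel (?E \<epsilon>) + (\<integral>\<^sup>+x. \<integral>\<^sup>+t. h x t \<partial>lborel \<partial>lborel)"
    by (subst nn_integral_add) (auto simp: nn_integral_cmult_indicator)
  also have "(\<integral>\<^sup>+x. \<integral>\<^sup>+t. h x t \<partial>lborel \<partial>lborel) = (\<integral>\<^sup>+t. \<integral>\<^sup>+x. h x t \<partial>lborel \<partial>lborel)"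
    by (rule lborel_pair.Fubini'[symmetric, OF h])
  also have "\<dots> = (\<integral>\<^sup>+t\<in>{0<..\<epsilon>}. ?g t * emeasure lborel (?E t) \<partial>lborel)"
  proof (rule nn_integral_cong)
    fix t
    show "(\<integral>\<^sup>+x. h x t \<partial>lborel) = ?g t * emeasure lborel (?E t) * indicator {0<..\<epsilon>} t"
    proof (cases "t \<in> {0<..\<epsilon>}")
      case True
      then have "(\<lambda>x. h x t) = (\<lambda>x. ?g t * indicator (?E t) x)"
        by (auto simp: h_def fun_eq_iff indicator_def)
      then show ?thesis using True by (simp add: nn_integral_cmult_indicator)
    next
      case False
      then have "(\<lambda>x. h x t) = (\<lambda>x. 0)" by (auto simp: h_def fun_eq_iff)
      then show ?thesis using False by simp
    qed
  qed
  finally show ?thesis .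
qed

lemma nn_integral_powr_weight:
  fixes s c \<epsilon> :: real
  assumes s: "0 < s" "s < 1" and "0 < \<epsilon>" "0 \<le> c"
  shows "(\<integral>\<^sup>+t\<in>{0<..\<epsilon>}. ennreal ((1 - s) * t powr (s - 2)) * ennreal (c * t) \<partial>lborel)
    = ennreal ((1 - s) * c * (\<epsilon> powr s / s))"
proof -
  \<comment> \<open>Adding the endpoint 0 changes nothing even pointwise, since
    \<open>0 powr (s - 1)\<close> is 0.\<close>
  let ?F = "\<lambda>t. if t \<in> {0..\<epsilon>} then (1 - s) * c * t powr (s - 1) else 0"
  have "(\<integral>\<^sup>+t\<in>{0<..\<epsilon>}. ennreal ((1 - s) * t powr (s - 2)) * ennreal (c * t) \<partial>lborel)
      = (\<integral>\<^sup>+t. ennreal (?F t) \<partial>lborel)"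
  proof (rule nn_integral_cong)
    fix t
    show "ennreal ((1 - s) * t powr (s - 2)) * ennreal (c * t) * indicator {0<..\<epsilon>} t = ennreal (?F t)"
    proof (cases "t \<in> {0<..\<epsilon>}")
      case True
      then have "(1 - s) * t powr (s - 2) * (c * t) = (1 - s) * c * (t * t powr (s - 2))" by simp
      also have "t * t powr (s - 2) = t powr (s - 1)" using True by (subst powr_mult_base) auto
      finally show ?thesis using True s \<open>0 \<le> c\<close> by (simp add: ennreal_mult[symmetric])
    next
      case False
      then show ?thesis by (cases "t = 0") auto
    qed
  qed
  also have "\<dots> = ennreal ((1 - s) * c * (\<epsilon> powr s / s))"
  proof (rule nn_integral_has_integral_lborel)
    have "((\<lambda>t. t powr (s - 1)) has_integral (\<epsilon> powr s / s)) {0..\<epsilon>}"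
      using has_integral_powr_from_0[of "s - 1" \<epsilon>] s \<open>0 < \<epsilon>\<close> by simp
    then have "((\<lambda>t. (1 - s) * c * t powr (s - 1)) has_integral ((1 - s) * c * (\<epsilon> powr s / s))) {0..\<epsilon>}"
      by (rule has_integral_mult_right)
    then show "(?F has_integral ((1 - s) * c * (\<epsilon> powr s / s))) UNIV"
      by (simp only: has_integral_restrict_UNIV)
  qed (use s \<open>0 \<le> c\<close> in auto)
  finally show ?thesis .
qed

text \<open>For the linear profile c t the boundary term is c \<epsilon>^s and the integral is (1 -
  s) c \<epsilon>^s / s. Multiplied by s, they add up to c \<epsilon>^s without any error
  term.\<close>

lemma linear_growth_value:
  fixes s c \<epsilon> :: real
  assumes s: "0 < s" "s < 1" and "0 < \<epsilon>" "0 \<le> c"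
  shows "ennreal s * (ennreal (\<epsilon> powr (s - 1)) * ennreal (c * \<epsilon>)
    + (\<integral>\<^sup>+t\<in>{0<..\<epsilon>}. ennreal ((1 - s) * t powr (s - 2)) * ennreal (c * t) \<partial>lborel)) = ennreal (c * \<epsilon> powr s)"
proof -
  have "\<epsilon> * \<epsilon> powr (s - 1) = \<epsilon> powr s" using \<open>0 < \<epsilon>\<close> by (subst powr_mult_base) auto
  then have "\<epsilon> powr (s - 1) * (c * \<epsilon>) = c * \<epsilon> powr s" by (simp add: algebra_simps)
  then have "ennreal (\<epsilon> powr (s - 1)) * ennreal (c * \<epsilon>) = ennreal (c * \<epsilon> powr s)"
    using \<open>0 < \<epsilon>\<close> \<open>0 \<le> c\<close> by (simp add: ennreal_mult[symmetric])
  moreover have "s * (c * \<epsilon> powr s + (1 - s) * c * (\<epsilon> powr s / s)) = c * \<epsilon> powr s"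
    using s by (simp add: field_simps)
  moreover have "0 \<le> c * \<epsilon> powr s" "0 \<le> (1 - s) * c * (\<epsilon> powr s / s)"
    using s \<open>0 \<le> c\<close> by auto
  ultimately show ?thesis
    unfolding nn_integral_powr_weight[OF assms]
    using s(1) by (simp only: ennreal_plus[symmetric] ennreal_mult[symmetric] add_nonneg_nonneg less_imp_le)
qed

text \<open>The right-hand side of the layer cake formula is monotone in the measures of the
  sublevel sets, so these can be compared with a linear profile.\<close>

lemma layer_cake_bounds:
  fixes f :: "'a::euclidean_space \<Rightarrow> real"
  assumes f: "f \<in> borel_measurable borel" and s: "0 < s" "s < 1" and "0 < \<epsilon>" "0 \<le> c"
  shows layer_cake_upper: "(\<And>t. 0 < t \<Longrightarrow> t \<le> \<epsilon> \<Longrightarrow> emeasure lborel {x. 0 < f x \<and> f x \<le> t} \<le> ennreal (c * t)) \<Longrightarrow>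
      ennreal s * (\<integral>\<^sup>+x\<in>{x. 0 < f x \<and> f x \<le> \<epsilon>}. ennreal (f x powr (s - 1)) \<partial>lborel) \<le> ennreal (c * \<epsilon> powr s)"
    and layer_cake_lower: "(\<And>t. 0 < t \<Longrightarrow> t \<le> \<epsilon> \<Longrightarrow> ennreal (c * t) \<le> emeasure lborel {x. 0 < f x \<and> f x \<le> t}) \<Longrightarrow>
      ennreal (c * \<epsilon> powr s) \<le> ennreal s * (\<integral>\<^sup>+x\<in>{x. 0 < f x \<and> f x \<le> \<epsilon>}. ennreal (f x powr (s - 1)) \<partial>lborel)"
  unfolding layer_cake[OF f s \<open>0 < \<epsilon>\<close>] linear_growth_value[OF s \<open>0 < \<epsilon>\<close> \<open>0 \<le> c\<close>, symmetric]
  using \<open>0 < \<epsilon>\<close>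
  by (auto intro!: mult_left_mono add_mono nn_integral_mono simp: indicator_def)

subsection \<open>The limit\<close>

text \<open>Here \<open>s\<close> stands for 1/k. Within distance \<epsilon> of \<open>A\<close> the
  layer cake bounds apply; farther away the integrand is at most 1/\<epsilon> whatever
  \<open>s\<close> is, which gives the error term proportional to \<open>s\<close>. The condition
  \<epsilon> \<le> R places the tube inside the disc of radius 2 R.\<close>

lemma scaled_integral_bounds:
  fixes A :: "(real^2) set"
  assumes A: "compact A" "A \<noteq> {}" "A \<subseteq> cball 0 R" and null: "emeasure lborel A = 0"
    and \<epsilon>: "0 < \<epsilon>" "\<epsilon> \<le> 1" "\<epsilon> \<le> R" and c: "0 \<le> c" "0 \<le> c'" and s: "0 < s" "s < 1"
    and lo: "\<And>t. 0 < t \<Longrightarrow> t \<le> \<epsilon> \<Longrightarrow> ennreal (c * t) \<le> emeasure lborel (tube A t)"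
    and up: "\<And>t. 0 < t \<Longrightarrow> t \<le> \<epsilon> \<Longrightarrow> emeasure lborel (tube A t) \<le> ennreal (c' * t)"
  defines "I \<equiv> (\<integral>\<^sup>+y\<in>cball 0 (2 * R). ennreal ((norm (gradient (\<lambda>x. infdist x A) y) / \<bar>infdist y A\<bar>) powr (1 - s)) \<partial>lebesgue)"
  shows "ennreal (c * \<epsilon> powr s) \<le> ennreal s * I"
    and "ennreal s * I \<le> ennreal (c' * \<epsilon> powr s + s * (measure lborel (cball (0::real^2) (2 * R)) / \<epsilon>))"
proof -
  let ?f = "\<lambda>x. infdist x A"
  let ?B = "cball (0::real^2) (2 * R)"
  define E where "E t = {x. 0 < ?f x \<and> ?f x \<le> t}" for t
  define J where "J = (\<integral>\<^sup>+x\<in>E \<epsilon>. ennreal (?f x powr (s - 1)) \<partial>lborel)"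
  have f [measurable]: "?f \<in> borel_measurable borel"
    by (intro borel_measurable_continuous_onI continuous_intros)
  have zero: "?f x = 0 \<longleftrightarrow> x \<in> A" for x
    using in_closed_iff_infdist_zero[OF compact_imp_closed[OF A(1)] A(2)] by auto
  have Et: "emeasure lborel (E t) = emeasure lborel (tube A t)" if "0 < t" for t
  proof -
    have "x \<in> tube A t \<longleftrightarrow> x \<in> E t \<union> A" for x
      unfolding tube_eq_infdist[OF A(1,2)] E_def
      using infdist_nonneg[of x A] zero[of x] that by (cases "x \<in> A") auto
    then have "tube A t = E t \<union> A" by blast
    moreover have "E t \<in> sets lborel" unfolding E_def by measurable
    moreover have "A \<in> null_sets lborel" using A(1) null by (auto simp: null_sets_def borel_compact)
    ultimately show ?thesis by (simp add: emeasure_Un_null_set)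
  qed
  have J_lo: "ennreal (c * \<epsilon> powr s) \<le> ennreal s * J"
    unfolding J_def E_def
    by (rule layer_cake_lower[OF f s \<epsilon>(1) c(1)]) (use lo Et in \<open>simp add: E_def\<close>)
  have J_up: "ennreal s * J \<le> ennreal (c' * \<epsilon> powr s)"
    unfolding J_def E_def
    by (rule layer_cake_upper[OF f s \<epsilon>(1) c(2)]) (use up Et in \<open>simp add: E_def\<close>)
  \<comment> \<open>Passing from \<open>lebesgue\<close> to \<open>lborel\<close> and changing the
    integrand on a null set are both valid for arbitrary functions, so the gradient is never shown
    to be measurable.\<close>
  have "I = (\<integral>\<^sup>+y\<in>?B. ennreal ((norm (gradient ?f y) / \<bar>?f y\<bar>) powr (1 - s)) \<partial>lborel)"
    unfolding I_def by (rule nn_integral_completion)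
  also have "\<dots> = (\<integral>\<^sup>+y\<in>?B. ennreal (?f y powr (s - 1)) \<partial>lborel)"
  proof (rule nn_integral_cong_AE)
    show "AE y in lborel. ennreal ((norm (gradient ?f y) / \<bar>?f y\<bar>) powr (1 - s)) * indicator ?B y
        = ennreal (?f y powr (s - 1)) * indicator ?B y"
      using AE_norm_gradient_infdist[OF A(1,2)]
    proof eventually_elim
      case (elim y)
      show ?case
      proof (cases "y \<in> A")
        \<comment> \<open>On \<open>A\<close> the distance is 0; division by 0 and powers of 0 are
          0, so both sides vanish.\<close>
        case True
        then show ?thesis by simp
      next
        case False
        then have "0 < ?f y" using zero[of y] infdist_nonneg[of y A] by linarith
        then have "(1 / ?f y) powr (1 - s) = ?f y powr (s - 1)"
          by (simp add: powr_divide powr_minus_divide[of _ "1 - s", symmetric])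
        then show ?thesis using elim False \<open>0 < ?f y\<close> by simp
      qed
    qed
  qed
  finally have I: "I = (\<integral>\<^sup>+y\<in>?B. ennreal (?f y powr (s - 1)) \<partial>lborel)" .
  have "E \<epsilon> \<subseteq> ?B"
  proof
    fix y assume "y \<in> E \<epsilon>"
    then have "y \<in> tube A \<epsilon>" unfolding tube_eq_infdist[OF A(1,2)] E_def by simp
    then obtain p where "p \<in> A" "dist y p \<le> \<epsilon>" unfolding tube_def by blast
    moreover have "norm p \<le> R" using A(3) \<open>p \<in> A\<close> by auto
    ultimately have "norm y \<le> 2 * R"
      using norm_triangle_sub[of y p] \<epsilon>(3) by (simp add: dist_norm)
    then show "y \<in> ?B" by simp
  qed
  then have "J \<le> I"
    unfolding I J_def by (intro nn_integral_mono) (auto simp: indicator_def)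
  with J_lo show "ennreal (c * \<epsilon> powr s) \<le> ennreal s * I"
    by (meson mult_left_mono order_trans zero_le)
  have "I \<le> (\<integral>\<^sup>+y. ennreal (?f y powr (s - 1)) * indicator (E \<epsilon>) y + ennreal (1 / \<epsilon>) * indicator ?B y \<partial>lborel)"
    unfolding I
  proof (rule nn_integral_mono)
    fix y
    have "?f y powr (s - 1) \<le> 1 / \<epsilon>" if "y \<notin> E \<epsilon>"
    proof (cases "?f y = 0")
      case False
      then have "\<epsilon> < ?f y" using that infdist_nonneg[of y A] by (auto simp: E_def)
      then have "?f y powr (s - 1) \<le> \<epsilon> powr (s - 1)"
        using \<epsilon>(1) s(2) by (intro powr_mono2') auto
      also have "\<dots> \<le> \<epsilon> powr - 1" using \<epsilon>(1,2) s(1) by (intro powr_mono') auto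
      also have "\<dots> = 1 / \<epsilon>" using \<epsilon>(1) by (simp add: powr_minus_divide)
      finally show ?thesis .
    qed (use \<epsilon>(1) in simp)
    then show "ennreal (?f y powr (s - 1)) * indicator ?B y
        \<le> ennreal (?f y powr (s - 1)) * indicator (E \<epsilon>) y + ennreal (1 / \<epsilon>) * indicator ?B y"
      by (auto simp: indicator_def intro: ennreal_leI)
  qed
  also have "\<dots> = J + ennreal (1 / \<epsilon>) * emeasure lborel ?B"
  proof -
    have [measurable]: "E \<epsilon> \<in> sets borel" unfolding E_def by measurable
    have [measurable]: "?B \<in> sets borel" by simp
    show ?thesis unfolding J_def by (subst nn_integral_add) (auto simp: nn_integral_cmult_indicator)
  qed
  also have "emeasure lborel ?B = ennreal (measure lborel ?B)"
    using emeasure_bounded_finite[OF bounded_cball, of "0::real^2" "2 * R"]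
    by (intro emeasure_eq_ennreal_measure) (simp add: less_top)
  also have "ennreal (1 / \<epsilon>) * ennreal (measure lborel ?B) = ennreal (measure lborel ?B / \<epsilon>)"
    using \<epsilon>(1) by (simp add: ennreal_mult[symmetric])
  finally have "ennreal s * I \<le> ennreal s * (J + ennreal (measure lborel ?B / \<epsilon>))"
    by (intro mult_left_mono) auto
  also have "\<dots> = ennreal s * J + ennreal s * ennreal (measure lborel ?B / \<epsilon>)" by (rule distrib_left)
  also have "\<dots> \<le> ennreal (c' * \<epsilon> powr s) + ennreal s * ennreal (measure lborel ?B / \<epsilon>)"
    by (intro add_right_mono J_up)
  also have "\<dots> = ennreal (c' * \<epsilon> powr s + s * (measure lborel ?B / \<epsilon>))"
    using c(2) s(1) \<epsilon>(1) by (simp add: ennreal_mult[symmetric] ennreal_plus[symmetric] del: ennreal_plus)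
  finally show "ennreal s * I \<le> ennreal (c' * \<epsilon> powr s + s * (measure lborel ?B / \<epsilon>))" .
qed

text \<open>The upper tube bound at radius 0; the slack 1 is arbitrary.\<close>

lemma closed_C1_curve_null:
  assumes "compact A" "C1_embedded_curve A" "hausdorff1 A < \<infinity>"
  shows "emeasure lborel A = 0"
proof -
  obtain L where L: "hausdorff1 A = ennreal L" "0 \<le> L" using assms(3) by (cases "hausdorff1 A") auto
  obtain \<tau> where \<tau>: "0 < \<tau>" "\<And>t. 0 \<le> t \<Longrightarrow> t \<le> \<tau> \<Longrightarrow> emeasure lborel (tube A t) \<le> ennreal ((2 * L + 1) * t)"
    using minkowski_content[OF assms(1,2) L, of 1] by (metis zero_less_one)
  have "A \<subseteq> tube A 0" by (auto simp: tube_def)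
  then have "emeasure lborel A \<le> emeasure lborel (tube A 0)"
    using compact_tube[OF assms(1)] by (intro emeasure_mono) (auto simp: borel_compact)
  also have "\<dots> \<le> 0" using \<tau>(2)[of 0] \<tau>(1) by simp
  finally show ?thesis by simp
qed

theorem theorem6p1:
  fixes R :: real and A :: "(real^2) set" and f :: "real^2 \<Rightarrow> real"
  assumes "R > 0"
    and "A \<noteq> {}"
    and "closed_C1_embedded_curve A"
    and "A \<subseteq> cball 0 R"
    and "hausdorff1 A < \<infinity>"
    and "\<And>x. f x = infdist x A"
  shows "((\<lambda>k::nat. ennreal (1 / real k) *
            (\<integral>\<^sup>+y\<in>cball 0 (2 * R).
               ennreal ((norm (gradient f y) / \<bar>f y\<bar>) powr ((real k - 1) / real k)) \<partial>lebesgue))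
          \<longlonglongrightarrow> 2 * hausdorff1 A)"
proof -
  have A: "compact A" "C1_embedded_curve A"
    using assms(3) by (auto simp: closed_C1_embedded_curve_def)
  obtain L where L: "hausdorff1 A = ennreal L" "0 \<le> L" using assms(5) by (cases "hausdorff1 A") auto
  have f: "f = (\<lambda>x. infdist x A)" using assms(6) by (intro ext)
  define F where "F k = ennreal (1 / real k) * (\<integral>\<^sup>+y\<in>cball 0 (2 * R).
      ennreal ((norm (gradient f y) / \<bar>f y\<bar>) powr ((real k - 1) / real k)) \<partial>lebesgue)" for k :: nat
  define M where "M = measure lborel (cball (0::real^2) (2 * R))"
  have bounds: "\<forall>\<^sub>F k in sequentially. ennreal (2 * L - 2 * \<eta>) \<le> F k \<and> F k \<le> ennreal (2 * L + 2 * \<eta>)"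
    if \<eta>: "0 < \<eta>" for \<eta>
  proof -
    obtain \<tau> where \<tau>: "0 < \<tau>"
      "\<And>t. 0 \<le> t \<Longrightarrow> t \<le> \<tau> \<Longrightarrow> ennreal ((2 * L - \<eta>) * t) \<le> emeasure lborel (tube A t)"
      "\<And>t. 0 \<le> t \<Longrightarrow> t \<le> \<tau> \<Longrightarrow> emeasure lborel (tube A t) \<le> ennreal ((2 * L + \<eta>) * t)"
      using minkowski_content[OF A L \<eta>] by metis
    define \<epsilon> where "\<epsilon> = min \<tau> (min 1 R)"
    have \<epsilon>: "0 < \<epsilon>" "\<epsilon> \<le> 1" "\<epsilon> \<le> R" "\<epsilon> \<le> \<tau>" using \<tau>(1) assms(1) by (auto simp: \<epsilon>_def)
    \<comment> \<open>The layer cake bounds ask for a nonnegative rate, while 2 L - \<eta> may be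
      negative.\<close>
    define c where "c = max 0 (2 * L - \<eta>)"
    have c: "0 \<le> c" "0 \<le> 2 * L + \<eta>" using L(2) \<eta> by (auto simp: c_def)
    have lo: "ennreal (c * t) \<le> emeasure lborel (tube A t)" if "0 < t" "t \<le> \<epsilon>" for t
      using \<tau>(2)[of t] that \<epsilon>(4) by (cases "2 * L - \<eta> \<le> 0") (auto simp: c_def max_def)
    have up: "emeasure lborel (tube A t) \<le> ennreal ((2 * L + \<eta>) * t)" if "0 < t" "t \<le> \<epsilon>" for t
      using \<tau>(3)[of t] that \<epsilon>(4) by simp
    \<comment> \<open>From k = 2 on, s = 1/k lies strictly between 0 and 1.\<close>
    have F_bounds: "ennreal (c * \<epsilon> powr (1 / real k)) \<le> F k
        \<and> F k \<le> ennreal ((2 * L + \<eta>) * \<epsilon> powr (1 / real k) + 1 / real k * (M / \<epsilon>))" if "2 \<le> k" for k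
    proof -
      have s: "0 < 1 / real k" "1 / real k < 1" using that by auto
      have "(real k - 1) / real k = 1 - 1 / real k" using that by (simp add: diff_divide_distrib)
      then show ?thesis
        unfolding F_def f M_def
        using scaled_integral_bounds[OF A(1) assms(2,4) closed_C1_curve_null[OF A assms(5)] \<epsilon>(1-3) c s lo up]
        by simp
    qed
    \<comment> \<open>With \<epsilon> fixed, \<epsilon>^(1/k) tends to 1 and the far part M/(k
      \<epsilon>) to 0; enlarging \<eta> to 2 \<eta> makes the limits strictly interior.\<close>
    have "(\<lambda>k. 1 / real k) \<longlonglongrightarrow> 0" by (rule lim_1_over_n)
    from tendsto_powr[OF tendsto_const this, of \<epsilon>] tendsto_mult[OF this tendsto_const, of "M / \<epsilon>"]
    have s0: "(\<lambda>k. \<epsilon> powr (1 / real k)) \<longlonglongrightarrow> \<epsilon> powr 0" "(\<lambda>k. 1 / real k * (M / \<epsilon>)) \<longlonglongrightarrow> 0 * (M / \<epsilon>)"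
      using \<epsilon>(1) by simp_all
    have "(\<lambda>k. c * \<epsilon> powr (1 / real k)) \<longlonglongrightarrow> c * \<epsilon> powr 0"
      "(\<lambda>k. (2 * L + \<eta>) * \<epsilon> powr (1 / real k) + 1 / real k * (M / \<epsilon>)) \<longlonglongrightarrow> (2 * L + \<eta>) * \<epsilon> powr 0 + 0 * (M / \<epsilon>)"
      by (intro tendsto_mult tendsto_add tendsto_const s0)+
    moreover have "2 * L - 2 * \<eta> < c * \<epsilon> powr 0" "(2 * L + \<eta>) * \<epsilon> powr 0 + 0 * (M / \<epsilon>) < 2 * L + 2 * \<eta>"
      using \<eta> \<epsilon>(1) by (auto simp: c_def)
    ultimately have "\<forall>\<^sub>F k in sequentially. 2 * L - 2 * \<eta> < c * \<epsilon> powr (1 / real k)"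
      "\<forall>\<^sub>F k in sequentially. (2 * L + \<eta>) * \<epsilon> powr (1 / real k) + 1 / real k * (M / \<epsilon>) < 2 * L + 2 * \<eta>"
      by (auto dest: order_tendstoD)
    then show ?thesis
      using eventually_ge_at_top[of 2]
    proof eventually_elim
      case (elim k)
      then show ?case
        using F_bounds[of k] by (meson ennreal_leI less_imp_le order_trans)
    qed
  qed
  have "F \<longlonglongrightarrow> ennreal (2 * L)"
  proof (rule order_tendstoI)
    fix y assume y: "y < ennreal (2 * L)"
    then obtain r where r: "y = ennreal r" "0 \<le> r" by (cases y) auto
    then have "r < 2 * L" using y by (simp add: ennreal_less_iff)
    \<comment> \<open>With this choice of \<eta>, 2 L - 2 \<eta> is the midpoint of \<open>r\<close>
      and 2 L.\<close>
    then have "0 < (2 * L - r) / 4" "r < 2 * L - 2 * ((2 * L - r) / 4)" by (simp_all add: field_simps)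
    then have "y < ennreal (2 * L - 2 * ((2 * L - r) / 4))"
      using r by (simp only: r(1) ennreal_less_iff)
    then show "\<forall>\<^sub>F k in sequentially. y < F k"
      using bounds[OF \<open>0 < (2 * L - r) / 4\<close>] by (elim eventually_mono) (blast intro: less_le_trans)
  next
    fix y assume y: "ennreal (2 * L) < y"
    show "\<forall>\<^sub>F k in sequentially. F k < y"
    proof (cases y)
      case (real r)
      then have "2 * L < r" using y L(2) by (simp add: ennreal_less_iff)
      then have "0 < (r - 2 * L) / 4" "2 * L + 2 * ((r - 2 * L) / 4) < r" by (simp_all add: field_simps)
      then have "ennreal (2 * L + 2 * ((r - 2 * L) / 4)) < y"
        using real L(2) by (simp only: real(1)) (intro ennreal_lessI, auto)
      then show ?thesis
        using bounds[OF \<open>0 < (r - 2 * L) / 4\<close>] by (elim eventually_mono) (blast intro: le_less_trans)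
    next
      case top
      show ?thesis
        using bounds[OF zero_less_one] by (auto elim!: eventually_mono simp: top intro: le_less_trans)
    qed
  qed
  moreover have "2 * hausdorff1 A = ennreal (2 * L)" using L by (simp add: ennreal_mult)
  ultimately show ?thesis unfolding F_def by simp
qed

end
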